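(* Let $\widetilde{\mathcal H}_{\mathcal T}$ be the specified Feynman graphs bialgebra associated with a theory $\mathcal T$. For all $\chi,\eta\in\widetilde{\mathcal L}(\widetilde{\mathcal H}_{\mathcal T},\mathcal B)$ and all specified graphs $(\Gamma,\underline i)$, define the convolution product $\circledast$ by $$(\chi\circledast\eta)(\Gamma,\underline i)=(\chi\circledast\eta)(\Gamma)=\sum_{(\gamma,\underline j)\subset(\Gamma,\underline i),\ (\Gamma,\underline i)/(\gamma,\underline j)\in\mathcal T}\pi_{\gamma,\Gamma}[\chi(\gamma)]\; i_{\Gamma,\gamma}\big[\eta\big(\Gamma/(\gamma,\underline j)\big)\big],$$ where the product used in the right-hand side is the pointwise product in $V_\Gamma$. Then the product $\circledast$ is associative.
   Context: Graphs. A (Feynman) graph $\Gamma$ consists of a finite set $\mathcal V(\Gamma)$ of vertices, a finite set $\mathcal E(\Gamma)$ of half-edges, an involution $\sigma_\Gamma:\mathcal E(\Gamma)\to\mathcal E(\Gamma)$ and a map $\partial:\mathcal E(\Gamma)\to\mathcal V(\Gamma)$. For a vertex $v$, $st(v)=\{e:\partial(e)=v\}$. Fixed points of $\sigma_\Gamma$ are the external edges; pairs $\{e,\sigma_\Gamma(e)\}$ with $e\ne\sigma_\Gamma(e)$ are the internal edges. Cutting an internal edge means modifying $\sigma_\Gamma$ so that its two half-edges become fixed points. $\pi_0(\Gamma)$ is the set of connected components. A graph is 1PI if it is connected and remains connected when any internal edge is cut; it is locally 1PI if each of its connected components is 1PI. A covering subgraph $\gamma$ of $\Gamma$ is a graph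 (not necessarily connected) obtained from $\Gamma$ by cutting internal edges (possibly none, possibly all); it has the same vertices and half-edges as $\Gamma$. The contracted graph $\Gamma/\gamma$ is obtained by shrinking each connected component of $\gamma$ inside $\Gamma$ onto a point; its half-edges are the half-edges of $\Gamma$ not belonging to internal edges of $\gamma$, so $\mathcal E(\Gamma/\gamma)\subset\mathcal E(\Gamma)$. The residue is $\mathrm{res}\,\Gamma=\Gamma/\Gamma$. Theory. A theory $\mathcal T$ prescribes a set $\mathcal E(\mathcal T)$ of types of half-edges (the involutions $\sigma_\Gamma$ respect types) and a set $\mathcal V(\mathcal T)$ of types of vertices, a vertex type being a function $\mathcal E(\mathcal T)\to\mathbb N$ giving the number of half-edges of each type at the vertex. It also prescribes a set $\widetilde{\mathcal V}(\mathcal T)$ of refined types of vertices, written $(t,k)$ with $t\in\mathcal V(\mathcal T)$ the underlying type, the index $k$ serving to distinguish refined types with the same underlying type. A locally 1PI graph is superficially divergent if the residue of each of its connected components is a vertex with type in $\mathcal V(\mathcal T)$. Specified graphs. A specified graph of $\mathcal T$ is a pair $\bar\Gamma=(\Gamma,\underline i)$ where $\Gamma$ is a locally 1PI superficially divergent graph with half-edges and vertices of the types prescribed in $\mathcal T$, and $\underline i:\pi_0(\Gamma)\to\mathbb N$, the values of $\underline i$ on a connected component being prescribed by the possible (refined) types of the vertex obtained by contracting this component onto a point. A specified graph $(\gamma,\underline j)$ is a specified covering subgraph of $(\Gamma,\underline i)$, written $(\gamma,\underline j)\subset(\Gamma,\underline i)$, if $\gamma$ is a covering subgraph of $\Gamma$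 and $\underline j(\gamma_0)=\underline i(\gamma_0)$ for every connected component $\gamma_0$ of $\gamma$ which is also a full connected component of $\Gamma$. The contracted specified graph is $\bar\Gamma/\bar\gamma=(\Gamma/\bar\gamma,\underline i)$, where $\Gamma/\bar\gamma=\Gamma/(\gamma,\underline j)$ is obtained by contracting each connected component of $\gamma$ onto a point and specifying the vertex obtained with $\underline j$. $\widetilde{\mathcal H}_{\mathcal T}$ is the vector space generated by the specified graphs, with product given by concatenation (disjoint union), unit the empty graph, and coproduct $\Delta(\bar\Gamma)=\sum_{\bar\gamma\subseteq\bar\Gamma,\ \bar\Gamma/\bar\gamma\in\mathcal T}\bar\gamma\otimes\bar\Gamma/\bar\gamma$, summed over the locally 1PI specified covering subgraphs $\bar\gamma$ of $\bar\Gamma$ such that $\bar\Gamma/\bar\gamma$ is in the theory $\mathcal T$. Function spaces. Fix an integer $D\ge1$. The momentum space of $\Gamma$ is $$W_\Gamma=\Big\{p:\mathcal E(\Gamma)\to\mathbb R^D\ :\ \sum_{e\in st(v)}p_e=0\ \forall v\in\mathcal V(\Gamma),\ \ p_e+p_{\sigma_\Gamma(e)}=0\ \forall e\in\mathcal E(\Gamma)\text{ with }e\ne\sigma_\Gamma(e)\Big\}.$$ For $\Gamma$ connected, $V_\Gamma=\mathcal C^\infty(W_\Gamma,\mathbb C)$; in general $V_\Gamma=\bigotimes_jV_{\Gamma_j}$ is the unordered tensor product over the connected components $\Gamma_j$ of $\Gamma$, identified with a subspace of $\mathcal C^\infty(W_\Gamma,\mathbb C)$ via $(\bigotimes_jv_j)(p)=\prod_jv_j(p|_{\mathcal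 E(\Gamma_j)})$. $\mathcal B=\prod_\Gamma V_\Gamma$, product over all graphs, connected or not. For $\gamma$ a covering subgraph of $\Gamma$: $\mathcal F_{\Gamma,\gamma}:W_\Gamma\to W_{\Gamma/\gamma}$ is the projection neglecting the internal momenta of $\gamma$, i.e. the restriction of $p$ to $\mathcal E(\Gamma/\gamma)\subset\mathcal E(\Gamma)$, and $i_{\Gamma,\gamma}=\mathcal F_{\Gamma,\gamma}^*:V_{\Gamma/\gamma}\to V_\Gamma$ is the pullback of functions; $\mathcal G_{\gamma,\Gamma}:W_\Gamma\hookrightarrow W_\gamma$ is the natural inclusion, and $\pi_{\gamma,\Gamma}=\mathcal G_{\gamma,\Gamma}^*:V_\gamma\to V_\Gamma$ is the restriction of functions. Both are morphisms of algebras. $\widetilde{\mathcal L}(\widetilde{\mathcal H}_{\mathcal T},\mathcal B)$ consists of the $\mathbb C$-linear maps $\chi:\widetilde{\mathcal H}_{\mathcal T}\to\mathcal B$ such that (1) $\chi$ does not depend on the specification of $\Gamma$, in other words $\chi(\Gamma,\underline i)=\chi(\Gamma)$; (2) $\chi(\Gamma)\in V_\Gamma$ for any graph $\Gamma$, i.e. the projection of $\chi(\Gamma)$ on $V_{\Gamma'}$ vanishes for any graph $\Gamma'\ne\Gamma$; (3) $\chi(\Gamma)=\mathbf 1_{V_\Gamma}$ if $\Gamma$ has no internal edges, where $\mathbf 1_{V_\Gamma}$ is the constant function equal to $1$ on $W_\Gamma$.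
   Formalization: Independence of (χ⊛η)(Γ,i) from i is claimed only for connected Γ, as it fails for some disconnected Γ with non-multiplicative χ, η; each vertex type has finitely many refinements; a component without internal edges keeps its vertex's index; associativity holds for all specified graphs. *)

theory Defs
  imports "HOL-Analysis.Analysis" "HOL-Library.Poly_Mapping"
begin

section \<open>Feynman graphs\<close>

record ('v, 'h) fgraph =
  verts :: "'v set"
  halfs :: "'h set"
  invol :: "'h \<Rightarrow> 'h"
  bd :: "'h \<Rightarrow> 'v"

text \<open>Half-edges carry a type; a vertex carries an index \<open>k\<close>. The underlying type \<open>t\<close> of a
  vertex is read off from its star, so that its refined type is \<open>(t, k)\<close>.\<close>

record ('v, 'h, 'e) tgraph = "('v, 'h) fgraph" +
  htype :: "'h \<Rightarrow> 'e"
  vindex :: "'v \<Rightarrow> nat"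

text \<open>All maps are extensional (\<^const>\<open>undefined\<close> off their domain), so that equality of records
  is equality of graphs.\<close>

definition fgraph :: "('v, 'h, 'z) fgraph_scheme \<Rightarrow> bool" where
  "fgraph G \<longleftrightarrow> finite (verts G) \<and> finite (halfs G) \<and>
     invol G \<in> halfs G \<rightarrow>\<^sub>E halfs G \<and> (\<forall>h\<in>halfs G. invol G (invol G h) = h) \<and>
     bd G \<in> halfs G \<rightarrow>\<^sub>E verts G"

definition tgraph :: "('v, 'h, 'e) tgraph \<Rightarrow> bool" where
  "tgraph G \<longleftrightarrow> fgraph G \<and> htype G \<in> extensional (halfs G) \<and> vindex G \<in> extensional (verts G) \<and>
     (\<forall>h\<in>halfs G. htype G (invol G h) = htype G h)"

definition star :: "('v, 'h, 'z) fgraph_scheme \<Rightarrow> 'v \<Rightarrow> 'h set" where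
  "star G v = {h \<in> halfs G. bd G h = v}"

text \<open>The half-edges that belong to internal edges.\<close>

definition internal :: "('v, 'h, 'z) fgraph_scheme \<Rightarrow> 'h set" where
  "internal G = {h \<in> halfs G. invol G h \<noteq> h}"

definition cut :: "('v, 'h, 'z) fgraph_scheme \<Rightarrow> 'h set \<Rightarrow> ('v, 'h, 'z) fgraph_scheme" where
  "cut G S = G\<lparr>invol := \<lambda>h. if h \<in> S then h else invol G h\<rparr>"

definition adj :: "('v, 'h, 'z) fgraph_scheme \<Rightarrow> ('v \<times> 'v) set" where
  "adj G = {(bd G h, bd G (invol G h)) | h. h \<in> internal G}"

text \<open>Connected components are represented by their vertex sets.\<close>

definition comp_of :: "('v, 'h, 'z) fgraph_scheme \<Rightarrow> 'v \<Rightarrow> 'v set" where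
  "comp_of G v = {w \<in> verts G. (v, w) \<in> (adj G)\<^sup>*}"

definition pi0 :: "('v, 'h, 'z) fgraph_scheme \<Rightarrow> 'v set set" where
  "pi0 G = comp_of G ` verts G"

definition comp_graph :: "('v, 'h, 'z) fgraph_scheme \<Rightarrow> 'v set \<Rightarrow> ('v, 'h) fgraph" where
  "comp_graph G C = (let H = {h \<in> halfs G. bd G h \<in> C} in
     \<lparr>verts = C, halfs = H, invol = restrict (invol G) H, bd = restrict (bd G) H\<rparr>)"

definition connected_graph :: "('v, 'h, 'z) fgraph_scheme \<Rightarrow> bool" where
  "connected_graph G \<longleftrightarrow> card (pi0 G) = 1"

definition one_PI :: "('v, 'h, 'z) fgraph_scheme \<Rightarrow> bool" where
  "one_PI G \<longleftrightarrow> connected_graph G \<and>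
     (\<forall>h\<in>internal G. connected_graph (cut G {h, invol G h}))"

definition locally_1PI :: "('v, 'h, 'z) fgraph_scheme \<Rightarrow> bool" where
  "locally_1PI G \<longleftrightarrow> (\<forall>C\<in>pi0 G. one_PI (comp_graph G C))"

definition covering_subgraph ::
  "('v, 'h, 'z) fgraph_scheme \<Rightarrow> ('v, 'h, 'z) fgraph_scheme \<Rightarrow> bool" where
  "covering_subgraph g G \<longleftrightarrow> (\<exists>S \<subseteq> internal G. invol G ` S \<subseteq> S \<and> g = cut G S)"

text \<open>The point onto which a component is shrunk is named after the least vertex of that
  component. With this convention, contracting in two steps or in one gives equal (not only
  isomorphic) graphs.\<close>

definition contract ::
  "('v::linorder, 'h, 'z) fgraph_scheme \<Rightarrow> ('v, 'h, 'z) fgraph_scheme \<Rightarrow> ('v, 'h) fgraph" where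
  "contract G g = (let H = halfs G - internal g in
     \<lparr>verts = Min ` pi0 g, halfs = H, invol = restrict (invol G) H,
      bd = (\<lambda>h\<in>H. Min (comp_of g (bd G h)))\<rparr>)"

definition residue_graph :: "('v::linorder, 'h, 'z) fgraph_scheme \<Rightarrow> ('v, 'h) fgraph" where
  "residue_graph G = contract G G"


section \<open>Theories and specified graphs\<close>

record 'e qft =
  half_types :: "'e set"
  vertex_types :: "('e \<Rightarrow> nat) set"
  refined_types :: "(('e \<Rightarrow> nat) \<times> nat) set"

text \<open>Vertex types, being functions on \<^const>\<open>half_types\<close>, are extended by zero. A vertex type
  has only finitely many refinements: otherwise the coproduct and the convolution product would
  be infinite sums.\<close>

definition qft :: "'e qft \<Rightarrow> bool" where
  "qft T \<longleftrightarrow> (\<forall>t\<in>vertex_types T. \<forall>a. a \<notin> half_types T \<longrightarrow> t a = 0) \<and>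
     refined_types T \<subseteq> vertex_types T \<times> UNIV \<and>
     (\<forall>t\<in>vertex_types T. finite {k. (t, k) \<in> refined_types T})"

definition star_type :: "('h \<Rightarrow> 'e) \<Rightarrow> ('v, 'h, 'z) fgraph_scheme \<Rightarrow> 'v \<Rightarrow> ('e \<Rightarrow> nat)" where
  "star_type \<tau> G v = (\<lambda>a. card {h \<in> star G v. \<tau> h = a})"

text \<open>The type of the unique vertex \<open>Min C\<close> of the residue of the component \<open>C\<close>.\<close>

definition res_type :: "('v::linorder, 'h, 'e) tgraph \<Rightarrow> 'v set \<Rightarrow> ('e \<Rightarrow> nat)" where
  "res_type G C = star_type (htype G) (residue_graph (comp_graph G C)) (Min C)"

definition superficially_divergent :: "'e qft \<Rightarrow> ('v::linorder, 'h, 'e) tgraph \<Rightarrow> bool" where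
  "superficially_divergent T G \<longleftrightarrow> (\<forall>C\<in>pi0 G. res_type G C \<in> vertex_types T)"

definition has_types_of :: "'e qft \<Rightarrow> ('v, 'h, 'e) tgraph \<Rightarrow> bool" where
  "has_types_of T G \<longleftrightarrow> (\<forall>h\<in>halfs G. htype G h \<in> half_types T) \<and>
     (\<forall>v\<in>verts G. (star_type (htype G) G v, vindex G v) \<in> refined_types T)"

text \<open>The indices that the vertex obtained by contracting \<open>C\<close> may have. If \<open>C\<close> has no internal
  edge there is nothing to contract: the vertex is already there, with a given refined type.\<close>

definition possible_indices :: "'e qft \<Rightarrow> ('v::linorder, 'h, 'e) tgraph \<Rightarrow> 'v set \<Rightarrow> nat set" where
  "possible_indices T G C = {k. (res_type G C, k) \<in> refined_types T \<and>
     (internal (comp_graph G C) = {} \<longrightarrow> k = vindex G (Min C))}"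

type_synonym ('v, 'h, 'e) spec_graph = "('v, 'h, 'e) tgraph \<times> ('v set \<Rightarrow> nat)"

definition specified_graphs :: "'e qft \<Rightarrow> ('v::linorder, 'h, 'e) spec_graph set" where
  "specified_graphs T = {(G, i). tgraph G \<and> has_types_of T G \<and> locally_1PI G \<and>
     superficially_divergent T G \<and> i \<in> (\<Pi>\<^sub>E C\<in>pi0 G. possible_indices T G C)}"

text \<open>A component of \<open>g\<close> is a full component of \<open>G\<close> when it is one as a graph: equality of the
  vertex sets would not exclude that some of its internal edges have been cut.\<close>

definition spec_subgraph ::
  "('v, 'h, 'e) spec_graph \<Rightarrow> ('v, 'h, 'e) spec_graph \<Rightarrow> bool" where
  "spec_subgraph = (\<lambda>(g, j) (G, i). covering_subgraph g G \<and>
     (\<forall>C \<in> pi0 g \<inter> pi0 G. comp_graph g C = comp_graph G C \<longrightarrow> j C = i C))"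

definition contract_typed ::
  "('v::linorder, 'h, 'e) tgraph \<Rightarrow> ('v, 'h, 'e) spec_graph \<Rightarrow> ('v, 'h, 'e) tgraph" where
  "contract_typed G = (\<lambda>(g, j). let K = contract G g in
     \<lparr>verts = verts K, halfs = halfs K, invol = invol K, bd = bd K,
      htype = restrict (htype G) (halfs K),
      vindex = (\<lambda>v\<in>verts K. j (comp_of g v))\<rparr>)"

text \<open>The components of the contracted graph correspond to those of \<open>G\<close>; as its vertices are
  also vertices of \<open>G\<close>, each of them lies inside the component of \<open>G\<close> it comes from.\<close>

definition contract_spec ::
  "('v::linorder, 'h, 'e) spec_graph \<Rightarrow> ('v, 'h, 'e) spec_graph \<Rightarrow> ('v, 'h, 'e) spec_graph" where
  "contract_spec = (\<lambda>(G, i) s. let K = contract_typed G s in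
     (K, \<lambda>C\<in>pi0 K. i (comp_of G (Min C))))"


section \<open>Momenta and functions of momenta\<close>

text \<open>The dimension \<open>D\<close> is \<open>CARD('d)\<close>. Momenta are extended by zero to all of \<^typ>\<open>'h\<close>.\<close>

type_synonym ('h, 'd) momenta = "'h \<Rightarrow> real ^ 'd"

definition momentum_space :: "('v, 'h, 'z) fgraph_scheme \<Rightarrow> ('h, 'd::finite) momenta set" where
  "momentum_space G = {p. (\<forall>h. h \<notin> halfs G \<longrightarrow> p h = 0) \<and>
     (\<forall>v\<in>verts G. (\<Sum>h\<in>star G v. p h) = 0) \<and>
     (\<forall>h\<in>internal G. p h + p (invol G h) = 0)}"

definition restr :: "'h set \<Rightarrow> ('h, 'd::finite) momenta \<Rightarrow> ('h, 'd) momenta" where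
  "restr A p = (\<lambda>h. if h \<in> A then p h else 0)"

text \<open>\<open>C\<^sup>k\<close> functions on a finite-dimensional space \<open>W\<close> of momenta: all iterated directional
  derivatives up to order \<open>k\<close>, in directions of \<open>W\<close>, exist and are continuous. The topology is
  the product topology, which induces the usual one on \<open>W\<close>.\<close>

primrec Ck_on :: "nat \<Rightarrow> ('h, 'd::finite) momenta set \<Rightarrow> (('h, 'd) momenta \<Rightarrow> complex) \<Rightarrow> bool" where
  "Ck_on 0 W f \<longleftrightarrow> continuous_on W f"
| "Ck_on (Suc k) W f \<longleftrightarrow> continuous_on W f \<and>
     (\<forall>w\<in>W. \<exists>f'. (\<forall>p\<in>W. ((\<lambda>t::real. f (\<lambda>h. p h + t *\<^sub>R w h)) has_vector_derivative f' p) (at 0)) \<and>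
        Ck_on k W f')"

text \<open>Functions on \<open>W\<close> are extended by zero off \<open>W\<close>.\<close>

definition smooth_functions ::
  "('h, 'd::finite) momenta set \<Rightarrow> (('h, 'd) momenta \<Rightarrow> complex) set" where
  "smooth_functions W = {f. (\<forall>k. Ck_on k W f) \<and> (\<forall>p. p \<notin> W \<longrightarrow> f p = 0)}"

text \<open>The tensor product over the components, realised as the span of the products of functions
  of the momenta of the single components. For connected \<open>G\<close> this is the space of all smooth
  functions, and for the empty graph it is the space of constants.\<close>

definition V_space ::
  "('v, 'h, 'z) fgraph_scheme \<Rightarrow> (('h, 'd::finite) momenta \<Rightarrow> complex) set" where
  "V_space G = {f. \<exists>(N::nat) (c :: nat \<Rightarrow> complex) u.
     (\<forall>n<N. \<forall>C\<in>pi0 G. u n C \<in> smooth_functions (momentum_space (comp_graph G C))) \<and>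
     f = (\<lambda>p. if p \<in> momentum_space G
            then \<Sum>n<N. c n * (\<Prod>C\<in>pi0 G. u n C (restr (halfs (comp_graph G C)) p)) else 0)}"

definition one_V :: "('v, 'h, 'z) fgraph_scheme \<Rightarrow> ('h, 'd::finite) momenta \<Rightarrow> complex" where
  "one_V G = (\<lambda>p. if p \<in> momentum_space G then 1 else 0)"

text \<open>\<open>pull_contract G g\<close> is the pullback \<open>V(G/g) \<rightarrow> V(G)\<close> along the projection of momenta, and
  \<open>pull_sub g G\<close> is the restriction \<open>V(g) \<rightarrow> V(G)\<close> along the inclusion of momentum spaces.\<close>

definition pull_contract ::
  "('v::linorder, 'h, 'z) fgraph_scheme \<Rightarrow> ('v, 'h, 'z) fgraph_scheme \<Rightarrow>
    (('h, 'd::finite) momenta \<Rightarrow> complex) \<Rightarrow> (('h, 'd) momenta \<Rightarrow> complex)" where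
  "pull_contract G g f =
     (\<lambda>p. if p \<in> momentum_space G then f (restr (halfs (contract G g)) p) else 0)"

definition pull_sub ::
  "('v, 'h, 'z) fgraph_scheme \<Rightarrow> ('v, 'h, 'z) fgraph_scheme \<Rightarrow>
    (('h, 'd::finite) momenta \<Rightarrow> complex) \<Rightarrow> (('h, 'd) momenta \<Rightarrow> complex)" where
  "pull_sub g G f = (\<lambda>p. if p \<in> momentum_space G then f p else 0)"

text \<open>Elements of the product of all the \<open>V(G)\<close> are families indexed by typed graphs, with value
  zero at records that are not graphs.\<close>

type_synonym ('v, 'h, 'e, 'd) family =
  "('v, 'h, 'e) tgraph \<Rightarrow> ('h, 'd) momenta \<Rightarrow> complex"

definition B_space :: "('v, 'h, 'e, 'd::finite) family set" where
  "B_space = {F. \<forall>G. (tgraph G \<longrightarrow> F G \<in> V_space G) \<and> (\<not> tgraph G \<longrightarrow> F G = (\<lambda>_. 0))}"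


section \<open>The convolution product\<close>

text \<open>The vector space generated by the specified graphs, and the maps defined on it.\<close>

definition H_tilde :: "'e qft \<Rightarrow> (('v::linorder, 'h, 'e) spec_graph \<Rightarrow>\<^sub>0 complex) set" where
  "H_tilde T = {x. Poly_Mapping.keys x \<subseteq> specified_graphs T}"

type_synonym ('v, 'h, 'e, 'd) graph_map =
  "(('v, 'h, 'e) spec_graph \<Rightarrow>\<^sub>0 complex) \<Rightarrow> ('v, 'h, 'e, 'd) family"

abbreviation gen :: "('v, 'h, 'e) spec_graph \<Rightarrow> (('v, 'h, 'e) spec_graph \<Rightarrow>\<^sub>0 complex)" where
  "gen s \<equiv> Poly_Mapping.single s 1"

definition linear_on_H ::
  "'e qft \<Rightarrow> ('v::linorder, 'h, 'e, 'd::finite) graph_map \<Rightarrow> bool" where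
  "linear_on_H T \<phi> \<longleftrightarrow>
     (\<forall>x\<in>H_tilde T. \<forall>y\<in>H_tilde T. \<phi> (x + y) = (\<lambda>G p. \<phi> x G p + \<phi> y G p)) \<and>
     (\<forall>x\<in>H_tilde T. \<forall>c. \<phi> (Poly_Mapping.map ((*) c) x) = (\<lambda>G p. c * \<phi> x G p))"

definition L_tilde :: "'e qft \<Rightarrow> ('v::linorder, 'h, 'e, 'd::finite) graph_map set" where
  "L_tilde T = {\<phi>. (\<forall>x\<in>H_tilde T. \<phi> x \<in> B_space) \<and> linear_on_H T \<phi> \<and>
     (\<forall>G i i'. (G, i) \<in> specified_graphs T \<and> (G, i') \<in> specified_graphs T \<longrightarrow>
        \<phi> (gen (G, i)) = \<phi> (gen (G, i'))) \<and>
     (\<forall>G i G'. (G, i) \<in> specified_graphs T \<and> G' \<noteq> G \<longrightarrow> \<phi> (gen (G, i)) G' = (\<lambda>_. 0)) \<and>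
     (\<forall>G i. (G, i) \<in> specified_graphs T \<and> internal G = {} \<longrightarrow> \<phi> (gen (G, i)) G = one_V G)}"

text \<open>The component in \<open>V(G)\<close> of the value at the specified graph \<open>(G, i)\<close>.\<close>

definition at_graph ::
  "('v, 'h, 'e, 'd) graph_map \<Rightarrow> ('v, 'h, 'e) spec_graph \<Rightarrow> ('h, 'd::finite) momenta \<Rightarrow> complex" where
  "at_graph \<phi> s = \<phi> (gen s) (fst s)"

definition theory_subgraphs ::
  "'e qft \<Rightarrow> ('v::linorder, 'h, 'e) spec_graph \<Rightarrow> ('v, 'h, 'e) spec_graph set" where
  "theory_subgraphs T s = {r \<in> specified_graphs T. spec_subgraph r s \<and>
     contract_spec s r \<in> specified_graphs T}"

definition conv_at ::
  "'e qft \<Rightarrow> ('v::linorder, 'h, 'e, 'd::finite) graph_map \<Rightarrow> ('v, 'h, 'e, 'd) graph_map \<Rightarrow>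
    ('v, 'h, 'e) spec_graph \<Rightarrow> ('h, 'd) momenta \<Rightarrow> complex" where
  "conv_at T \<phi> \<eta> s = (\<lambda>p. \<Sum>r\<in>theory_subgraphs T s.
     pull_sub (fst r) (fst s) (at_graph \<phi> r) p *
     pull_contract (fst s) (fst r) (at_graph \<eta> (contract_spec s r)) p)"

text \<open>The linear extension of \<^const>\<open>conv_at\<close>, whose value at a specified graph \<open>(G, i)\<close> is
  concentrated in \<open>V(G)\<close>.\<close>

definition conv ::
  "'e qft \<Rightarrow> ('v::linorder, 'h, 'e, 'd::finite) graph_map \<Rightarrow> ('v, 'h, 'e, 'd) graph_map \<Rightarrow>
    ('v, 'h, 'e, 'd) graph_map" where
  "conv T \<phi> \<eta> x = (\<lambda>G p. \<Sum>s\<in>Poly_Mapping.keys x.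
     Poly_Mapping.lookup x s * (if G = fst s then conv_at T \<phi> \<eta> s p else 0))"

end

theory Submission
  imports Defs
begin

text \<open>For nested covering subgraphs \<open>q \<subseteq> r \<subseteq> s\<close>, the map \<open>(r, q) \<mapsto> (q, r/q)\<close> identifies the index set
  of the double sum for \<open>(\<phi> \<circledast> \<eta>) \<circledast> \<xi>\<close> with that for \<open>\<phi> \<circledast> (\<eta> \<circledast> \<xi>)\<close>, and the summands match
  because \<open>(s/q)/(r/q) = s/r\<close>. The condition that \<open>s/r\<close> belong to the theory holds automatically:
  the star of a vertex of \<open>s/r\<close> consists of the external half-edges of a component of \<open>r\<close>, whose
  residue has an admissible refined type. Local 1PI-ness is handled as the absence of bridges: two
  vertices of \<open>G\<close> are connected iff their images in \<open>G/g\<close> are, also after cutting an edge that is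
  not in \<open>g\<close>, so \<open>G\<close> and \<open>G/g\<close> have the same bridges outside \<open>g\<close>.\<close>

section \<open>Connectivity\<close>

text \<open>The value of \<open>conv T \<phi> \<eta>\<close> at \<open>(G, i)\<close> may depend on
  \<open>i\<close>, and a graph map sees the vertex indices of its argument. Hence the two triple
  products are matched through equations between specified graphs, indices included, never up to
  isomorphism. The least-vertex names make this possible: the least vertex of a component of
  \<open>G\<close> is also least in its component of any covering subgraph \<open>g\<close>, so it
  survives in \<open>G/g\<close> and a second contraction picks it again. The costly half of the
  reindexing is to lift a subgraph of \<open>s/q\<close> to a subgraph between \<open>q\<close> and
  \<open>s\<close>: absence of bridges must pass upward, and the indices must be consistent at
  isolated vertices and at components left whole. Independence of the specification is a separate
  claim about connected graphs. If one component of a disconnected graph stays whole while another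
  is cut, its index reappears as a vertex index of the contracted graph, on which
  \<open>\<eta>\<close> may depend, so the argument for a single component does not carry
  over.\<close>

lemma adj_iff: "(x, y) \<in> adj G \<longleftrightarrow> (\<exists>h\<in>internal G. x = bd G h \<and> y = bd G (invol G h))"
  by (auto simp: adj_def)

lemma fgraph_invol:
  assumes "fgraph G" "h \<in> halfs G"
  shows "invol G h \<in> halfs G" "invol G (invol G h) = h"
  using assms by (auto simp: fgraph_def)

lemma fgraph_bd: "fgraph G \<Longrightarrow> h \<in> halfs G \<Longrightarrow> bd G h \<in> verts G"
  by (auto simp: fgraph_def)

lemma internal_halfs: "h \<in> internal G \<Longrightarrow> h \<in> halfs G"
  by (simp add: internal_def)

lemma internal_invol:
  assumes "fgraph G" "h \<in> internal G"
  shows "invol G h \<in> internal G"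
  using assms fgraph_invol[of G h] by (auto simp: internal_def)

lemma adj_verts: "fgraph G \<Longrightarrow> (x, y) \<in> adj G \<Longrightarrow> x \<in> verts G \<and> y \<in> verts G"
  by (auto simp: adj_iff internal_def fgraph_bd fgraph_invol)

lemma sym_adj:
  assumes "fgraph G"
  shows "sym (adj G)"
proof (rule symI)
  fix x y assume "(x, y) \<in> adj G"
  then obtain h where "h \<in> internal G" "x = bd G h" "y = bd G (invol G h)"
    by (auto simp: adj_iff)
  then show "(y, x) \<in> adj G"
    unfolding adj_iff using internal_invol[OF assms] fgraph_invol(2)[OF assms internal_halfs]
    by (intro bexI[of _ "invol G h"]) simp_all
qed

lemma adj_rtrancl_sym: "fgraph G \<Longrightarrow> (x, y) \<in> (adj G)\<^sup>* \<Longrightarrow> (y, x) \<in> (adj G)\<^sup>*"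
  by (meson sym_adj sym_rtrancl symD)

lemma adj_rtrancl_verts:
  assumes "(x, y) \<in> (adj G)\<^sup>*" "fgraph G" "x \<in> verts G"
  shows "y \<in> verts G"
  using assms by (induction rule: rtrancl_induct) (auto dest: adj_verts)

lemma in_comp_of: "fgraph G \<Longrightarrow> v \<in> verts G \<Longrightarrow> w \<in> comp_of G v \<longleftrightarrow> (v, w) \<in> (adj G)\<^sup>*"
  by (auto simp: comp_of_def dest: adj_rtrancl_verts)

lemma comp_of_self: "v \<in> verts G \<Longrightarrow> v \<in> comp_of G v"
  by (simp add: comp_of_def)

lemma comp_of_verts: "comp_of G v \<subseteq> verts G"
  by (auto simp: comp_of_def)

lemma comp_of_vertsD: "w \<in> comp_of G v \<Longrightarrow> w \<in> verts G"
  by (simp add: comp_of_def)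

lemma comp_of_eq_iff:
  assumes "fgraph G" "v \<in> verts G" "w \<in> verts G"
  shows "comp_of G v = comp_of G w \<longleftrightarrow> (v, w) \<in> (adj G)\<^sup>*"
proof
  assume "comp_of G v = comp_of G w"
  then show "(v, w) \<in> (adj G)\<^sup>*"
    using comp_of_self[OF assms(3)] in_comp_of[OF assms(1,2)] by auto
next
  assume "(v, w) \<in> (adj G)\<^sup>*"
  then show "comp_of G v = comp_of G w"
    using adj_rtrancl_sym[OF assms(1)] by (auto simp: comp_of_def intro: rtrancl_trans)
qed

lemma comp_of_eqI:
  assumes "fgraph G" "v \<in> verts G" "w \<in> comp_of G v"
  shows "comp_of G w = comp_of G v"
proof -
  have "w \<in> verts G" "(v, w) \<in> (adj G)\<^sup>*"
    using assms in_comp_of[OF assms(1,2)] by (auto dest: comp_of_vertsD)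
  then show ?thesis using comp_of_eq_iff[OF assms(1,2)] by blast
qed

lemma comp_of_bd_invol:
  assumes "fgraph G" "h \<in> halfs G"
  shows "comp_of G (bd G (invol G h)) = comp_of G (bd G h)"
proof (cases "h \<in> internal G")
  case True
  then have "(bd G h, bd G (invol G h)) \<in> (adj G)\<^sup>*"
    by (intro r_into_rtrancl) (auto simp: adj_iff)
  then show ?thesis
    using comp_of_eq_iff[of G "bd G h" "bd G (invol G h)"] assms by (simp add: fgraph_bd fgraph_invol)
qed (use assms in \<open>auto simp: internal_def\<close>)

lemma finite_comp_of: "fgraph G \<Longrightarrow> finite (comp_of G v)"
  using comp_of_verts[of G v] by (auto simp: fgraph_def intro: finite_subset)

lemma Min_comp_of:
  fixes G :: "('v::linorder, 'h, 'z) fgraph_scheme"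
  assumes "fgraph G" "v \<in> verts G"
  shows "Min (comp_of G v) \<in> comp_of G v" "Min (comp_of G v) \<in> verts G"
    "comp_of G (Min (comp_of G v)) = comp_of G v"
proof -
  show 1: "Min (comp_of G v) \<in> comp_of G v"
    using assms comp_of_self[OF assms(2)] finite_comp_of by (intro Min_in) auto
  then show "Min (comp_of G v) \<in> verts G" by (rule comp_of_vertsD)
  show "comp_of G (Min (comp_of G v)) = comp_of G v" using comp_of_eqI[OF assms 1] .
qed

lemma Min_comp_of_eq_iff:
  fixes G :: "('v::linorder, 'h, 'z) fgraph_scheme"
  assumes "fgraph G" "v \<in> verts G" "w \<in> verts G"
  shows "Min (comp_of G v) = Min (comp_of G w) \<longleftrightarrow> comp_of G v = comp_of G w"
proof
  assume "Min (comp_of G v) = Min (comp_of G w)"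
  from arg_cong[OF this, of "comp_of G"] show "comp_of G v = comp_of G w"
    unfolding Min_comp_of(3)[OF assms(1,2)] Min_comp_of(3)[OF assms(1,3)] .
qed (rule arg_cong)

lemma pi0_cases:
  assumes "C \<in> pi0 G"
  obtains v where "v \<in> verts G" "C = comp_of G v"
  using assms by (auto simp: pi0_def)

lemma comp_of_in_pi0: "v \<in> verts G \<Longrightarrow> comp_of G v \<in> pi0 G"
  by (auto simp: pi0_def)

lemma finite_pi0: "fgraph G \<Longrightarrow> finite (pi0 G)"
  by (auto simp: pi0_def fgraph_def)

lemma connected_graph_comp_of:
  assumes "connected_graph G" "v \<in> verts G"
  shows "comp_of G v = verts G"
proof -
  obtain A where A: "pi0 G = {A}"
    using assms(1) unfolding connected_graph_def by (rule card_1_singletonE)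
  have "w \<in> comp_of G v" if "w \<in> verts G" for w
    using A comp_of_in_pi0[OF that] comp_of_in_pi0[OF assms(2)] comp_of_self[OF that] by blast
  then show ?thesis using comp_of_verts[of G v] by (intro equalityI subsetI) auto
qed

section \<open>Cutting edges\<close>

lemma cut_simps [simp]:
  "verts (cut G S) = verts G" "halfs (cut G S) = halfs G" "bd (cut G S) = bd G"
  "fgraph.more (cut G S) = fgraph.more G" "internal (cut G S) = internal G - S"
  "invol (cut G S) h = (if h \<in> S then h else invol G h)"
  by (auto simp: cut_def internal_def)

lemma cut_empty: "cut G {} = G"
  by (simp add: cut_def)

lemma fgraph_cut:
  assumes "fgraph G" "S \<subseteq> internal G" "invol G ` S \<subseteq> S"
  shows "fgraph (cut G S)"
proof -
  have *: "invol G h \<notin> S" if "h \<in> halfs G" "h \<notin> S" for h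
    using that assms(3) fgraph_invol(2)[OF assms(1) that(1)] by (metis imageI subsetD)
  have "S \<subseteq> halfs G" using assms(2) by (auto simp: internal_def)
  then have "invol (cut G S) \<in> halfs G \<rightarrow>\<^sub>E halfs G"
    using assms(1) by (fastforce simp: fgraph_def cut_def)
  moreover have "invol (cut G S) (invol (cut G S) h) = h" if "h \<in> halfs G" for h
    using that * fgraph_invol(2)[OF assms(1)] by simp
  ultimately show ?thesis
    using assms(1) unfolding fgraph_def by simp
qed

lemma fgraph_cut_edge:
  assumes "fgraph G" "h \<in> internal G"
  shows "fgraph (cut G {h, invol G h})"
  using internal_invol[OF assms] fgraph_invol(2)[OF assms(1) internal_halfs[OF assms(2)]] assms
  by (intro fgraph_cut) auto

lemma adj_cut: "adj (cut G S) = (\<lambda>h. (bd G h, bd G (invol G h))) ` (internal G - S)"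
  by (force simp: adj_def)

text \<open>A component is closed under adjacency, so an internal edge that starts in it also ends
  in it; this makes the restricted \<open>invol\<close> and \<open>bd\<close> agree with those of
  \<open>G\<close> on both half-edges. \<open>S\<close> is arbitrary so that \<open>S = {}\<close>
  covers plain connectedness.\<close>

lemma adj_comp_graph_cut:
  assumes "fgraph G" "v \<in> verts G"
  shows "adj (cut (comp_graph G (comp_of G v)) S) = Restr (adj (cut G S)) (comp_of G v)"
proof -
  have "bd G (invol G h) \<in> comp_of G v" if "h \<in> halfs G" "bd G h \<in> comp_of G v" for h
  proof -
    have "comp_of G (bd G (invol G h)) = comp_of G v"
      using comp_of_bd_invol[OF assms(1) that(1)] comp_of_eqI[OF assms that(2)] by simp
    then show ?thesis
      using comp_of_self[of "bd G (invol G h)" G] that(1) by (simp add: assms fgraph_bd fgraph_invol)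
  qed
  then have 1: "\<And>h. h \<in> internal (comp_graph G (comp_of G v)) \<longleftrightarrow> h \<in> internal G \<and> bd G h \<in> comp_of G v"
    and 2: "\<And>h. h \<in> internal G \<Longrightarrow> bd G h \<in> comp_of G v \<Longrightarrow> bd G (invol G h) \<in> comp_of G v"
    by (auto simp: internal_def comp_graph_def Let_def)
  have 3: "bd (comp_graph G (comp_of G v)) h = bd G h"
      "invol (comp_graph G (comp_of G v)) h = invol G h"
      "bd (comp_graph G (comp_of G v)) (invol G h) = bd G (invol G h)"
    if "h \<in> internal G" "bd G h \<in> comp_of G v" for h
    using that 2[OF that] assms(1)
    by (simp_all add: comp_graph_def Let_def internal_halfs fgraph_invol)
  have "adj (cut (comp_graph G (comp_of G v)) S) =
      (\<lambda>h. (bd G h, bd G (invol G h))) ` {h \<in> internal G - S. bd G h \<in> comp_of G v}"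
    unfolding adj_cut using 1 3 by (intro image_cong) auto
  also have "\<dots> = Restr (adj (cut G S)) (comp_of G v)"
    unfolding adj_cut using 2 by auto
  finally show ?thesis .
qed

text \<open>A path in the cut graph is a path in \<open>G\<close>, hence never leaves the component
  of \<open>v\<close>: isolating the component before or after the cut makes no difference.\<close>

lemma comp_of_comp_graph_cut:
  assumes "fgraph G" "v \<in> verts G" "w \<in> comp_of G v"
  shows "comp_of (cut (comp_graph G (comp_of G v)) S) w = comp_of (cut G S) w"
proof -
  let ?C = "comp_of G v"
  have sub: "adj (cut G S) \<subseteq> adj G" by (auto simp: adj_cut adj_def)
  have cl: "y \<in> ?C" if "x \<in> ?C" "(x, y) \<in> adj G" for x y
    using that in_comp_of[OF assms(1,2)] by (meson rtrancl.rtrancl_into_rtrancl)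
  have "x \<in> ?C \<and> (w, x) \<in> (adj (cut (comp_graph G ?C) S))\<^sup>*" if "(w, x) \<in> (adj (cut G S))\<^sup>*" for x
    using that
  proof induction
    case (step y z)
    then have "(y, z) \<in> Restr (adj (cut G S)) ?C" using cl sub by blast
    then show ?case
      using step unfolding adj_comp_graph_cut[OF assms(1,2), symmetric]
      by (meson cl sub subsetD rtrancl.rtrancl_into_rtrancl)
  qed (use assms in auto)
  moreover have "(adj (cut (comp_graph G ?C) S))\<^sup>* \<subseteq> (adj (cut G S))\<^sup>*"
    by (intro rtrancl_mono) (auto simp: adj_comp_graph_cut[OF assms(1,2)])
  ultimately show ?thesis
    using comp_of_verts[of G v] by (auto simp: comp_of_def comp_graph_def Let_def)
qed

text \<open>Replaces a count of components by reachability in the whole cut graph; the component is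
  non-empty, so a count of one means that all its vertices are linked.\<close>

lemma connected_comp_graph_cut:
  assumes "fgraph G" "v \<in> verts G" "fgraph (cut G S)"
  shows "connected_graph (cut (comp_graph G (comp_of G v)) S) \<longleftrightarrow>
    (\<forall>x\<in>comp_of G v. \<forall>y\<in>comp_of G v. (x, y) \<in> (adj (cut G S))\<^sup>*)"
proof -
  let ?C = "comp_of G v"
  have "pi0 (cut (comp_graph G ?C) S) = comp_of (cut G S) ` ?C"
    using comp_of_comp_graph_cut[OF assms(1,2)]
    by (auto simp: pi0_def comp_graph_def Let_def image_iff)
  then have "connected_graph (cut (comp_graph G ?C) S) \<longleftrightarrow> (\<exists>A. comp_of (cut G S) ` ?C = {A})"
    by (simp add: connected_graph_def card_1_singleton_iff)
  also have "\<dots> \<longleftrightarrow> (\<forall>x\<in>?C. \<forall>y\<in>?C. comp_of (cut G S) x = comp_of (cut G S) y)"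
    using comp_of_self[OF assms(2)] by blast
  also have "\<dots> \<longleftrightarrow> (\<forall>x\<in>?C. \<forall>y\<in>?C. (x, y) \<in> (adj (cut G S))\<^sup>*)"
    using comp_of_eq_iff[OF assms(3)] comp_of_verts[of G v] by (simp add: subset_eq)
  finally show ?thesis .
qed

text \<open>If the ends of a cut edge stay linked, every path through the edge can be rerouted, so
  no component splits; conversely, the cut component is connected and contains both ends. Components
  drop out of the condition, which can then be compared between \<open>G\<close>, \<open>g\<close>
  and \<open>G/g\<close>.\<close>

lemma locally_1PI_iff:
  assumes "fgraph G"
  shows "locally_1PI G \<longleftrightarrow>
    (\<forall>h\<in>internal G. (bd G h, bd G (invol G h)) \<in> (adj (cut G {h, invol G h}))\<^sup>*)"
proof
  assume L: "locally_1PI G"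
  show "\<forall>h\<in>internal G. (bd G h, bd G (invol G h)) \<in> (adj (cut G {h, invol G h}))\<^sup>*"
  proof
    fix h assume h: "h \<in> internal G"
    let ?v = "bd G h"
    have v: "?v \<in> verts G" using h assms by (simp add: fgraph_bd internal_halfs)
    have inv: "bd G (invol G h) \<in> comp_of G ?v"
      using comp_of_bd_invol[OF assms internal_halfs[OF h]] comp_of_self[of "bd G (invol G h)" G]
      by (simp add: fgraph_bd assms fgraph_invol internal_halfs[OF h])
    have hC: "h \<in> internal (comp_graph G (comp_of G ?v))"
      using h comp_of_self[OF v] by (auto simp: internal_def comp_graph_def Let_def)
    moreover have "invol (comp_graph G (comp_of G ?v)) h = invol G h"
      using h comp_of_self[OF v] by (auto simp: internal_def comp_graph_def Let_def)
    ultimately have "connected_graph (cut (comp_graph G (comp_of G ?v)) {h, invol G h})"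
      using L comp_of_in_pi0[OF v] by (force simp: locally_1PI_def one_PI_def)
    then show "(?v, bd G (invol G h)) \<in> (adj (cut G {h, invol G h}))\<^sup>*"
      using connected_comp_graph_cut[OF assms v fgraph_cut_edge[OF assms h]] comp_of_self[OF v] inv
      by blast
  qed
next
  assume R: "\<forall>h\<in>internal G. (bd G h, bd G (invol G h)) \<in> (adj (cut G {h, invol G h}))\<^sup>*"
  have sub: "(adj G)\<^sup>* \<subseteq> (adj (cut G {h, invol G h}))\<^sup>*" if h: "h \<in> internal G" for h
  proof (rule rtrancl_subset_rtrancl, rule subrelI)
    let ?A = "adj (cut G {h, invol G h})"
    fix x y assume "(x, y) \<in> adj G"
    then obtain k where k: "k \<in> internal G" "x = bd G k" "y = bd G (invol G k)"
      by (auto simp: adj_iff)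
    consider "k = h" | "k = invol G h" | "k \<notin> {h, invol G h}" by auto
    then show "(x, y) \<in> ?A\<^sup>*"
    proof cases
      \<comment> \<open>The partner half-edge runs the cut edge backwards, hence the appeal to
        symmetry of reachability.\<close>
      case 2
      then show ?thesis
        using k R h adj_rtrancl_sym[OF fgraph_cut_edge[OF assms h]] fgraph_invol[OF assms]
        by (metis internal_halfs)
    qed (use k R in \<open>auto simp: adj_cut\<close>)
  qed
  show "locally_1PI G"
    unfolding locally_1PI_def
  proof
    fix C assume "C \<in> pi0 G"
    then obtain v where v: "v \<in> verts G" "C = comp_of G v" by (rule pi0_cases)
    have C: "(x, y) \<in> (adj G)\<^sup>*" if "x \<in> C" "y \<in> C" for x y
      using that v in_comp_of[OF assms v(1)] adj_rtrancl_sym[OF assms] by (meson rtrancl_trans)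
    have "connected_graph (comp_graph G C)"
      using connected_comp_graph_cut[OF assms v(1), of "{}"] C assms v by (simp add: cut_empty)
    moreover have "connected_graph (cut (comp_graph G C) {h, invol (comp_graph G C) h})"
      if "h \<in> internal (comp_graph G C)" for h
    proof -
      have h: "h \<in> internal G" "invol (comp_graph G C) h = invol G h"
        using that by (auto simp: internal_def comp_graph_def Let_def)
      show ?thesis
        using connected_comp_graph_cut[OF assms v(1) fgraph_cut_edge[OF assms h(1)]] C v
          sub[OF h(1)] h(2) by auto
    qed
    ultimately show "one_PI (comp_graph G C)" by (simp add: one_PI_def)
  qed
qed

section \<open>Covering subgraphs and their contraction\<close>

lemma covering_subgraphD:
  assumes "covering_subgraph g G" "fgraph G"
  shows "fgraph g" "verts g = verts G" "halfs g = halfs G" "bd g = bd G"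
    "fgraph.more g = fgraph.more G" "internal g \<subseteq> internal G"
    "\<And>h. h \<in> internal g \<Longrightarrow> invol g h = invol G h"
proof -
  obtain S where S: "S \<subseteq> internal G" "invol G ` S \<subseteq> S" "g = cut G S"
    using assms(1) unfolding covering_subgraph_def by blast
  show "fgraph g" unfolding S(3) using assms(2) S(1,2) by (rule fgraph_cut)
  show "verts g = verts G" "halfs g = halfs G" "bd g = bd G" "fgraph.more g = fgraph.more G"
    "internal g \<subseteq> internal G" "\<And>h. h \<in> internal g \<Longrightarrow> invol g h = invol G h"
    unfolding S(3) by auto
qed

lemma fgraph_eqI:
  assumes "fgraph g" "fgraph G" "verts g = verts G" "halfs g = halfs G" "bd g = bd G"
    "fgraph.more g = fgraph.more G" "\<And>h. h \<in> halfs G \<Longrightarrow> invol g h = invol G h"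
  shows "g = G"
proof -
  have "invol g \<in> extensional (halfs G)" "invol G \<in> extensional (halfs G)"
    using assms(1,2,4) by (auto simp: fgraph_def PiE_def)
  then have "invol g = invol G" using assms(7) by (rule extensionalityI)
  then show ?thesis using assms(3-6) by (cases g; cases G) simp
qed

text \<open>Removes the existential over cut sets: the set to cut is every half-edge internal in
  \<open>G\<close> but not in \<open>g\<close>. It is stable under \<open>invol G\<close>, since a
  partner lying in \<open>internal g\<close> would be sent back into
  \<open>internal g\<close>.\<close>

lemma covering_subgraphI:
  assumes "fgraph g" "fgraph G" "verts g = verts G" "halfs g = halfs G" "bd g = bd G"
    "fgraph.more g = fgraph.more G" "\<And>h. h \<in> internal g \<Longrightarrow> invol g h = invol G h"
  shows "covering_subgraph g G"
proof -
  let ?S = "internal G - internal g"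
  have inv: "invol G ` ?S \<subseteq> ?S"
  proof (rule image_subsetI)
    fix h assume h: "h \<in> ?S"
    have "invol G h \<notin> internal g"
    proof
      assume A: "invol G h \<in> internal g"
      then have "invol g (invol G h) = h"
        using assms(7)[OF A] fgraph_invol(2)[OF assms(2) internal_halfs] h by simp
      with internal_invol[OF assms(1) A] h show False by simp
    qed
    then show "invol G h \<in> ?S" using h internal_invol[OF assms(2)] by simp
  qed
  have eq: "g = cut G ?S"
  proof (rule fgraph_eqI)
    show "fgraph (cut G ?S)" using assms(2) inv by (intro fgraph_cut) auto
    show "invol g h = invol (cut G ?S) h" if "h \<in> halfs (cut G ?S)" for h
      using that assms(4) assms(7)[of h] by (cases "h \<in> internal g") (auto simp: internal_def)
  qed (use assms in auto)
  show ?thesis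
    unfolding covering_subgraph_def by (rule exI[of _ ?S], intro conjI Diff_subset inv eq)
qed

lemma covering_subgraph_invol_mem:
  assumes "covering_subgraph g G" "fgraph G" "h \<in> halfs G"
  shows "invol G h \<in> internal g \<longleftrightarrow> h \<in> internal g"
proof -
  note c = covering_subgraphD[OF assms(1,2)]
  have "invol G h' \<in> internal g" if "h' \<in> internal g" for h'
    using internal_invol[OF c(1) that] c(7)[OF that] by simp
  from this[of h] this[of "invol G h"] show ?thesis
    using fgraph_invol(2)[OF assms(2,3)] by auto
qed

lemma adj_covering_subgraph:
  assumes "covering_subgraph g G" "fgraph G"
  shows "adj g \<subseteq> adj G"
  using covering_subgraphD(4,6,7)[OF assms] by (auto simp: adj_iff intro!: bexI)

lemma covering_subgraph_trans:
  assumes "covering_subgraph q r" "covering_subgraph r G" "fgraph G"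
  shows "covering_subgraph q G"
proof -
  note r = covering_subgraphD[OF assms(2,3)]
  note q = covering_subgraphD[OF assms(1) r(1)]
  show ?thesis
  proof (rule covering_subgraphI[OF q(1) assms(3)])
    show "invol q h = invol G h" if "h \<in> internal q" for h
      using q(7)[OF that] r(7)[of h] that q(6) by auto
  qed (use q r in auto)
qed

lemma covering_subgraph_mid:
  assumes "covering_subgraph q G" "covering_subgraph r G" "fgraph G" "internal q \<subseteq> internal r"
  shows "covering_subgraph q r"
proof -
  note r = covering_subgraphD[OF assms(2,3)]
  note q = covering_subgraphD[OF assms(1,3)]
  show ?thesis
  proof (rule covering_subgraphI[OF q(1) r(1)])
    show "invol q h = invol r h" if "h \<in> internal q" for h
      using q(7)[OF that] r(7)[of h] that assms(4) by auto
  qed (use q r in auto)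
qed

lemma tgraph_more_eq_iff:
  fixes g G :: "('v, 'h, 'e) tgraph"
  shows "fgraph.more g = fgraph.more G \<longleftrightarrow> htype g = htype G \<and> vindex g = vindex G"
  by (cases g; cases G) simp

lemma tgraph_fgraph: "tgraph G \<Longrightarrow> fgraph G"
  by (simp add: tgraph_def)

lemma covering_subgraph_types:
  fixes g G :: "('v, 'h, 'e) tgraph"
  assumes "covering_subgraph g G" "fgraph G"
  shows "htype g = htype G" "vindex g = vindex G"
  using covering_subgraphD(5)[OF assms] by (simp_all add: tgraph_more_eq_iff)

lemma covering_subgraph_tgraph:
  fixes g G :: "('v, 'h, 'e) tgraph"
  assumes "covering_subgraph g G" "tgraph G"
  shows "tgraph g"
proof -
  note f = tgraph_fgraph[OF assms(2)]
  note c = covering_subgraphD[OF assms(1) f] and t = covering_subgraph_types[OF assms(1) f]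
  have "htype g (invol g h) = htype g h" if "h \<in> halfs G" for h
    using that assms(2) c(3) c(7)[of h] t(1)
    by (cases "h \<in> internal g") (auto simp: tgraph_def internal_def)
  then show ?thesis using assms(2) c t by (simp add: tgraph_def)
qed

section \<open>Contraction as the vertex map \<open>root\<close>, which sends a vertex to the name
  of the point it becomes\<close>

definition root :: "('v::linorder, 'h, 'z) fgraph_scheme \<Rightarrow> 'v \<Rightarrow> 'v" where
  "root g v = Min (comp_of g v)"

lemma root_simps:
  assumes "fgraph g" "v \<in> verts g"
  shows "root g v \<in> comp_of g v" "root g v \<in> verts g" "comp_of g (root g v) = comp_of g v"
    "root g (root g v) = root g v"
  using Min_comp_of[OF assms] by (simp_all add: root_def)

lemma root_le: "fgraph g \<Longrightarrow> w \<in> comp_of g v \<Longrightarrow> root g v \<le> w"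
  by (simp add: root_def finite_comp_of)

lemma root_eq_iff:
  assumes "fgraph g" "v \<in> verts g" "w \<in> verts g"
  shows "root g v = root g w \<longleftrightarrow> (v, w) \<in> (adj g)\<^sup>*"
  unfolding root_def Min_comp_of_eq_iff[OF assms] comp_of_eq_iff[OF assms] ..

lemma contract_typed_simps:
  "verts (contract_typed G (g, j)) = root g ` verts g"
  "halfs (contract_typed G (g, j)) = halfs G - internal g"
  "invol (contract_typed G (g, j)) = restrict (invol G) (halfs G - internal g)"
  "bd (contract_typed G (g, j)) = (\<lambda>h\<in>halfs G - internal g. root g (bd G h))"
  "htype (contract_typed G (g, j)) = restrict (htype G) (halfs G - internal g)"
  "vindex (contract_typed G (g, j)) = (\<lambda>v\<in>root g ` verts g. j (comp_of g v))"
  by (simp_all add: contract_typed_def contract_def Let_def root_def pi0_def image_image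
      cong: restrict_cong)

locale covering =
  fixes G g :: "('v::linorder, 'h, 'e) tgraph" and j :: "'v set \<Rightarrow> nat"
  assumes fG: "fgraph G" and cov: "covering_subgraph g G"
begin

abbreviation K :: "('v, 'h, 'e) tgraph" where
  "K \<equiv> contract_typed G (g, j)"

lemmas sub = covering_subgraphD[OF cov fG]

lemma verts_K: "verts K = root g ` verts G"
  by (simp add: contract_typed_simps sub(2))

lemma verts_K_sub: "verts K \<subseteq> verts G"
  using root_simps(2)[OF sub(1)] by (auto simp: verts_K sub(2))

lemma root_in_verts_K: "v \<in> verts G \<Longrightarrow> root g v \<in> verts K"
  by (auto simp: verts_K)

lemma root_verts_K: "v \<in> verts K \<Longrightarrow> root g v = v"
  using root_simps(4)[OF sub(1)] by (auto simp: verts_K sub(2))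

lemma halfs_K: "h \<in> halfs K \<longleftrightarrow> h \<in> halfs G \<and> h \<notin> internal g"
  by (simp add: contract_typed_simps)

lemma invol_K: "h \<in> halfs K \<Longrightarrow> invol K h = invol G h"
  by (simp add: contract_typed_simps)

lemma bd_K: "h \<in> halfs K \<Longrightarrow> bd K h = root g (bd G h)"
  by (simp add: contract_typed_simps)

lemma internal_K: "internal K = internal G - internal g"
  by (auto simp: internal_def[of K] internal_def[of G] contract_typed_simps)

lemma invol_halfs_K: "h \<in> halfs K \<Longrightarrow> invol G h \<in> halfs K"
  using covering_subgraph_invol_mem[OF cov fG, of h] fgraph_invol(1)[OF fG] by (auto simp: halfs_K)

lemma fgraph_K: "fgraph K"
proof -
  have "finite (verts K)" "finite (halfs K)"
    using fG by (auto simp: fgraph_def verts_K contract_typed_simps(2))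
  moreover have "invol K \<in> halfs K \<rightarrow>\<^sub>E halfs K"
    using invol_halfs_K by (auto simp: contract_typed_simps)
  moreover have "invol K (invol K h) = h" if "h \<in> halfs K" for h
    using that invol_halfs_K[OF that] fgraph_invol(2)[OF fG] by (simp add: invol_K halfs_K)
  moreover have "bd K \<in> halfs K \<rightarrow>\<^sub>E verts K"
    using root_in_verts_K fgraph_bd[OF fG]
    by (auto simp: contract_typed_simps sub(2))
  ultimately show ?thesis by (simp add: fgraph_def)
qed

lemma tgraph_K: "tgraph G \<Longrightarrow> tgraph K"
  using fgraph_K invol_halfs_K
  by (auto simp: tgraph_def contract_typed_simps)

lemma adj_g_rtrancl: "(adj g)\<^sup>* \<subseteq> (adj G)\<^sup>*"
  by (intro rtrancl_mono adj_covering_subgraph[OF cov fG])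

lemma root_rtrancl: "v \<in> verts G \<Longrightarrow> (v, root g v) \<in> (adj G)\<^sup>*"
  using root_simps(1)[OF sub(1)] in_comp_of[OF sub(1)] adj_g_rtrancl by (auto simp: sub(2))

text \<open>A path in \<open>K\<close> lifts because each end of a lifted edge is joined to its root
  by a path inside \<open>g\<close>; conversely, an edge of \<open>G\<close> is either collapsed by
  \<open>g\<close> or survives in \<open>K\<close>.\<close>

lemma contract_rtrancl:
  assumes "v \<in> verts G" "w \<in> verts G"
  shows "(root g v, root g w) \<in> (adj K)\<^sup>* \<longleftrightarrow> (v, w) \<in> (adj G)\<^sup>*"
proof
  have "adj K \<subseteq> (adj G)\<^sup>*"
  proof (rule subrelI)
    fix x y assume "(x, y) \<in> adj K"
    then obtain h where h: "h \<in> internal K" "x = bd K h" "y = bd K (invol K h)"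
      by (auto simp: adj_iff)
    have hK: "h \<in> halfs K" using h(1) by (rule internal_halfs)
    have hG: "h \<in> internal G" using h(1) internal_K by simp
    then have v: "bd G h \<in> verts G" "bd G (invol G h) \<in> verts G"
      using fgraph_bd[OF fG] fgraph_invol(1)[OF fG] internal_halfs[OF hG] by simp_all
    have xy: "x = root g (bd G h)" "y = root g (bd G (invol G h))"
      using h(2,3) hK invol_halfs_K[OF hK] by (simp_all add: bd_K invol_K)
    have e: "(bd G h, bd G (invol G h)) \<in> (adj G)\<^sup>*"
      using hG by (intro r_into_rtrancl) (auto simp: adj_iff)
    show "(x, y) \<in> (adj G)\<^sup>*"
      unfolding xy
      by (rule rtrancl_trans[OF rtrancl_trans[OF adj_rtrancl_sym[OF fG root_rtrancl[OF v(1)]] e]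
            root_rtrancl[OF v(2)]])
  qed
  then have K: "(adj K)\<^sup>* \<subseteq> (adj G)\<^sup>*" by (rule rtrancl_subset_rtrancl)
  assume "(root g v, root g w) \<in> (adj K)\<^sup>*"
  then have "(root g v, root g w) \<in> (adj G)\<^sup>*" using K by blast
  then show "(v, w) \<in> (adj G)\<^sup>*"
    using root_rtrancl[OF assms(1)] adj_rtrancl_sym[OF fG root_rtrancl[OF assms(2)]]
    by (blast intro: rtrancl_trans)
next
  assume "(v, w) \<in> (adj G)\<^sup>*"
  then show "(root g v, root g w) \<in> (adj K)\<^sup>*"
  proof induction
    case (step y z)
    obtain h where h: "h \<in> internal G" "y = bd G h" "z = bd G (invol G h)"
      using step(2) by (auto simp: adj_iff)
    have yz: "y \<in> verts g" "z \<in> verts g" using adj_verts[OF fG step(2)] sub(2) by simp_all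
    have "(root g y, root g z) \<in> (adj K)\<^sup>*"
    proof (cases "h \<in> internal g")
      case True
      then have "(y, z) \<in> adj g" using h sub(4,7) by (auto simp: adj_iff)
      then have "root g y = root g z" using root_eq_iff[OF sub(1) yz] by blast
      then show ?thesis by simp
    next
      case False
      then have i: "h \<in> internal K" using h internal_K by simp
      have hK: "h \<in> halfs K" using i by (rule internal_halfs)
      have "bd K h = root g y" "bd K (invol K h) = root g z"
        using h(2,3) hK invol_halfs_K[OF hK] by (simp_all add: bd_K invol_K)
      then have "(root g y, root g z) \<in> adj K" using i unfolding adj_iff by (intro bexI[of _ h]) simp_all
      then show ?thesis by (rule r_into_rtrancl)
    qed
    with step(3) show ?case by (rule rtrancl_trans)
  qed simp
qed

lemma comp_of_K_iff:
  assumes "v \<in> verts G" "w \<in> verts K"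
  shows "root g v \<in> comp_of K w \<longleftrightarrow> v \<in> comp_of G w"
proof -
  have w: "w \<in> verts G" "root g w = w" using assms(2) verts_K_sub root_verts_K by auto
  show ?thesis
    using in_comp_of[OF fgraph_K assms(2)] in_comp_of[OF fG w(1)] contract_rtrancl[OF w(1) assms(1)] w(2)
    by simp
qed

lemma comp_of_K:
  assumes "w \<in> verts K"
  shows "comp_of K w = verts K \<inter> comp_of G w"
proof (rule set_eqI)
  fix x
  show "x \<in> comp_of K w \<longleftrightarrow> x \<in> verts K \<inter> comp_of G w"
    using comp_of_K_iff[OF _ assms, of x] comp_of_vertsD[of x K w] verts_K_sub root_verts_K[of x]
    by auto
qed

lemma comp_of_G_root: "v \<in> verts G \<Longrightarrow> comp_of G (root g v) = comp_of G v"
  using comp_of_eq_iff[OF fG, of v "root g v"] root_rtrancl[of v] root_in_verts_K[of v] verts_K_sub by auto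

lemma comp_of_g_sub:
  assumes "v \<in> verts G"
  shows "comp_of g v \<subseteq> comp_of G v"
  using adj_g_rtrancl by (auto simp: comp_of_def sub(2))

text \<open>The component in \<open>g\<close> of the least vertex of a component of \<open>G\<close>
  lies inside that component, so this vertex is its own root.\<close>

lemma root_G_in_verts_K:
  assumes "v \<in> verts G"
  shows "root G v \<in> verts K"
proof -
  let ?m = "root G v"
  have m: "?m \<in> verts G" "comp_of G ?m = comp_of G v" using root_simps[OF fG assms] by auto
  have "root g ?m \<in> comp_of G v"
    using root_simps(1)[OF sub(1), of ?m] comp_of_g_sub[OF m(1)] m sub(2) by auto
  then have "?m \<le> root g ?m" by (rule root_le[OF fG])
  moreover have "root g ?m \<le> ?m"
    using root_le[OF sub(1) comp_of_self] m(1) sub(2) by simp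
  ultimately have "root g ?m = ?m" by simp
  then show ?thesis using root_in_verts_K[OF m(1)] by simp
qed

text \<open>The component of \<open>w\<close> in \<open>K\<close> consists of the vertices of
  \<open>K\<close> in the component of \<open>w\<close> in \<open>G\<close>, and the minimum of the
  latter is one of them. Hence contraction does not change component representatives.\<close>

lemma root_K:
  assumes "w \<in> verts K"
  shows "root K w = root G w"
proof -
  have w: "w \<in> verts G" using assms verts_K_sub by auto
  have "root G w \<in> comp_of K w"
    using comp_of_K[OF assms] root_G_in_verts_K[OF w] root_simps(1)[OF fG w] by simp
  then have "root K w \<le> root G w" by (rule root_le[OF fgraph_K])
  moreover have "root G w \<le> root K w"
    using comp_of_K[OF assms] root_simps(1)[OF fgraph_K assms] by (intro root_le[OF fG]) simp
  ultimately show ?thesis by simp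
qed

end

section \<open>Bridges and residues under contraction\<close>

context covering
begin

text \<open>Edges outside \<open>g\<close> can be cut before or after contraction, so that
  \<open>contract_rtrancl\<close> becomes applicable to graphs with an edge already cut.\<close>

lemma contract_typed_cut:
  assumes "S \<subseteq> internal K"
  shows "contract_typed (cut G S) (g, j) = cut K S"
proof -
  have "S \<subseteq> halfs G - internal g"
    using assms internal_halfs[of _ K] by (auto simp: halfs_K)
  then have "restrict (invol (cut G S)) (halfs G - internal g) = invol (cut K S)"
    by (intro ext) (auto simp: contract_typed_simps restrict_def)
  moreover have "htype (cut G S) = htype G" "htype (cut K S) = htype K" "vindex (cut K S) = vindex K"
    by (simp_all add: cut_def)
  ultimately show ?thesis
    by (intro tgraph.equality) (simp_all add: contract_typed_simps)
qed

lemma covering_subgraph_cut_edge: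
  assumes "h \<in> internal K"
  shows "covering_subgraph g (cut G {h, invol G h})"
proof -
  have h: "h \<in> internal G" "h \<notin> internal g" using assms by (simp_all add: internal_K)
  have inv: "invol G h \<notin> internal g"
    using covering_subgraph_invol_mem[OF cov fG internal_halfs[OF h(1)]] h(2) by simp
  have "covering_subgraph (cut G {h, invol G h}) G"
    unfolding covering_subgraph_def
    using h(1) internal_invol[OF fG h(1)] fgraph_invol(2)[OF fG internal_halfs[OF h(1)]]
    by (intro exI[of _ "{h, invol G h}"]) auto
  then show ?thesis
    by (rule covering_subgraph_mid[OF cov _ fG]) (use h inv sub(6) in auto)
qed

lemma bridge_K_iff:
  assumes "h \<in> internal K"
  shows "(bd K h, bd K (invol K h)) \<in> (adj (cut K {h, invol K h}))\<^sup>* \<longleftrightarrow>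
    (bd G h, bd G (invol G h)) \<in> (adj (cut G {h, invol G h}))\<^sup>*"
proof -
  have h: "h \<in> internal G" "h \<in> halfs K" using assms internal_halfs[OF assms] by (simp_all add: internal_K)
  \<comment> \<open>The connectivity criterion is used for the cut graph, whose contraction is
    \<open>K\<close> cut at the same edge.\<close>
  interpret C: covering "cut G {h, invol G h}" g j
    by (rule covering.intro[OF fgraph_cut_edge[OF fG h(1)] covering_subgraph_cut_edge[OF assms]])
  have "{h, invol G h} \<subseteq> internal K"
    using assms internal_invol[OF fgraph_K assms] invol_K[OF h(2)] by simp
  then have K: "C.K = cut K {h, invol G h}" by (rule contract_typed_cut)
  have v: "bd G h \<in> verts G" "bd G (invol G h) \<in> verts G"
    using fgraph_bd[OF fG] fgraph_invol(1)[OF fG] internal_halfs[OF h(1)] by simp_all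
  have "bd K h = root g (bd G h)" "bd K (invol K h) = root g (bd G (invol G h))"
    using h(2) invol_halfs_K[OF h(2)] by (simp_all add: bd_K invol_K)
  then show ?thesis
    using C.contract_rtrancl[of "bd G h" "bd G (invol G h)"] v K invol_K[OF h(2)] by simp
qed

lemma locally_1PI_K:
  assumes "locally_1PI G"
  shows "locally_1PI K"
  using assms bridge_K_iff unfolding locally_1PI_iff[OF fG] locally_1PI_iff[OF fgraph_K]
  by (simp add: internal_K)

text \<open>An edge of \<open>g\<close> has a bypass inside \<open>g\<close>, and \<open>g\<close>
  with the edge cut still sits inside \<open>G\<close> with it cut; any other edge survives in
  \<open>K\<close>, and its bypass there lifts by \<open>bridge_K_iff\<close>. Needed to lift a
  subgraph of a contraction.\<close>

lemma locally_1PI_extension: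
  assumes "locally_1PI g" "locally_1PI K"
  shows "locally_1PI G"
  unfolding locally_1PI_iff[OF fG]
proof
  fix h assume h: "h \<in> internal G"
  show "(bd G h, bd G (invol G h)) \<in> (adj (cut G {h, invol G h}))\<^sup>*"
  proof (cases "h \<in> internal g")
    case True
    have "adj (cut g {h, invol G h}) \<subseteq> adj (cut G {h, invol G h})"
    proof -
      have "adj (cut g {h, invol G h}) =
          (\<lambda>h. (bd G h, bd G (invol G h))) ` (internal g - {h, invol G h})"
        unfolding adj_cut using sub(4,7) by (intro image_cong) auto
      then show ?thesis unfolding adj_cut using sub(6) by blast
    qed
    then have "(adj (cut g {h, invol G h}))\<^sup>* \<subseteq> (adj (cut G {h, invol G h}))\<^sup>*"
      by (rule rtrancl_mono)
    moreover have "(bd G h, bd G (invol G h)) \<in> (adj (cut g {h, invol G h}))\<^sup>*"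
      using assms(1) True sub(4) sub(7)[OF True] unfolding locally_1PI_iff[OF sub(1)] by auto
    ultimately show ?thesis by blast
  next
    case False
    then have "h \<in> internal K" using h internal_K by simp
    then show ?thesis
      using assms(2) bridge_K_iff unfolding locally_1PI_iff[OF fgraph_K] by simp
  qed
qed

end

section \<open>Residue types as counts of external half-edges\<close>

lemma comp_of_comp_graph:
  assumes "fgraph G" "v \<in> verts G" "w \<in> comp_of G v"
  shows "comp_of (comp_graph G (comp_of G v)) w = comp_of G v"
  using comp_of_comp_graph_cut[OF assms, of "{}"] comp_of_eqI[OF assms] by (simp add: cut_empty)

lemma comp_graph_simps:
  "verts (comp_graph G C) = C" "halfs (comp_graph G C) = {h \<in> halfs G. bd G h \<in> C}"
  "invol (comp_graph G C) = restrict (invol G) {h \<in> halfs G. bd G h \<in> C}"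
  "bd (comp_graph G C) = restrict (bd G) {h \<in> halfs G. bd G h \<in> C}"
  "internal (comp_graph G C) = {h \<in> internal G. bd G h \<in> C}"
  by (auto simp: comp_graph_def Let_def internal_def)

text \<open>The component shrinks to one point, whose star is therefore made of all external
  half-edges of the component. From here on residues are counts in \<open>G\<close> itself.\<close>

lemma res_type_comp_of:
  fixes G :: "('v::linorder, 'h, 'e) tgraph"
  assumes "fgraph G" "v \<in> verts G"
  shows "res_type G (comp_of G v) =
    (\<lambda>a. card {h \<in> halfs G - internal G. bd G h \<in> comp_of G v \<and> htype G h = a})"
proof -
  let ?C = "comp_of G v"
  have "star (residue_graph (comp_graph G ?C)) (Min ?C) = {h \<in> halfs G - internal G. bd G h \<in> ?C}"
  proof -
    have "bd (residue_graph (comp_graph G ?C)) h = Min ?C"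
      if "h \<in> halfs G" "bd G h \<in> ?C" "h \<notin> internal G" for h
      using that comp_of_comp_graph[OF assms that(2)]
      by (simp add: residue_graph_def contract_def Let_def comp_graph_simps)
    moreover have "halfs (residue_graph (comp_graph G ?C)) = {h \<in> halfs G - internal G. bd G h \<in> ?C}"
      by (auto simp: residue_graph_def contract_def Let_def comp_graph_simps)
    ultimately show ?thesis unfolding star_def by auto
  qed
  then show ?thesis
    unfolding res_type_def star_type_def by (intro ext arg_cong[of _ _ card]) auto
qed

context covering
begin

lemma external_K: "halfs K - internal K = halfs G - internal G"
  using sub(6) by (auto simp: halfs_K internal_K)

lemma bd_K_comp_of:
  assumes "w \<in> verts K" "h \<in> halfs K"
  shows "bd K h \<in> comp_of K w \<longleftrightarrow> bd G h \<in> comp_of G w"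
proof -
  have "bd G h \<in> verts G" using assms(2) fgraph_bd[OF fG] by (simp add: halfs_K)
  then show ?thesis using comp_of_K_iff[OF _ assms(1)] bd_K[OF assms(2)] by simp
qed

text \<open>Contraction deletes only half-edges that are internal in \<open>G\<close> and keeps
  every external one in the corresponding component.\<close>

lemma res_type_K:
  assumes "w \<in> verts K"
  shows "res_type K (comp_of K w) = res_type G (comp_of G w)"
proof -
  have w: "w \<in> verts G" using assms verts_K_sub by auto
  have ht: "htype K h = htype G h" if "h \<in> halfs K" for h
    using that by (simp add: contract_typed_simps)
  have "{h \<in> halfs K - internal K. bd K h \<in> comp_of K w \<and> htype K h = a} =
      {h \<in> halfs G - internal G. bd G h \<in> comp_of G w \<and> htype G h = a}" for a
    unfolding external_K[symmetric]
    by (rule Collect_cong) (use bd_K_comp_of[OF assms] ht in auto)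
  then show ?thesis
    unfolding res_type_comp_of[OF fgraph_K assms] res_type_comp_of[OF fG w] by simp
qed

lemma star_K:
  assumes "w \<in> verts K"
  shows "star K w = {h \<in> halfs K. bd G h \<in> comp_of g w}"
proof -
  have w: "w \<in> verts g" using assms verts_K_sub sub(2) by auto
  have "bd K h = w \<longleftrightarrow> bd G h \<in> comp_of g w" if "h \<in> halfs K" for h
  proof -
    have "bd G h \<in> verts g" using that fgraph_bd[OF fG] by (simp add: halfs_K sub(2))
    then show ?thesis
      using root_eq_iff[OF sub(1) w, of "bd G h"] in_comp_of[OF sub(1) w] root_verts_K[OF assms]
        bd_K[OF that] by auto
  qed
  then show ?thesis unfolding star_def by auto
qed

lemma star_type_K:
  assumes "w \<in> verts K"
  shows "star_type (htype K) K w = res_type g (comp_of g w)"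
proof -
  have w: "w \<in> verts g" using assms verts_K_sub sub(2) by auto
  have "{h \<in> star K w. htype K h = a} =
      {h \<in> halfs g - internal g. bd g h \<in> comp_of g w \<and> htype g h = a}" for a
    unfolding star_K[OF assms] sub(3,4) covering_subgraph_types(1)[OF cov fG]
    by (rule Collect_cong) (auto simp: contract_typed_simps)
  then show ?thesis
    unfolding res_type_comp_of[OF sub(1) w] star_type_def by simp
qed

end

section \<open>Specifications\<close>

text \<open>\<open>avoids G (internal G - internal g) v\<close> says that the component of \<open>g\<close> at \<open>v\<close> is a full component
  of \<open>G\<close>, and \<open>avoids G (internal G) v\<close> that \<open>v\<close> is an isolated vertex.\<close>

definition avoids :: "('v, 'h, 'z) fgraph_scheme \<Rightarrow> 'h set \<Rightarrow> 'v \<Rightarrow> bool" where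
  "avoids G A v \<longleftrightarrow> (\<forall>h\<in>A. bd G h \<notin> comp_of G v)"

lemma comp_of_avoids_internal:
  assumes "fgraph G" "v \<in> verts G" "avoids G (internal G) v"
  shows "comp_of G v = {v}"
proof -
  have "w = v" if "w \<in> comp_of G v" for w
  proof -
    have "(v, w) \<in> (adj G)\<^sup>*" using that in_comp_of[OF assms(1,2)] by simp
    then show ?thesis
    proof (cases rule: converse_rtranclE)
      case (step y)
      then obtain h where "h \<in> internal G" "v = bd G h" by (auto simp: adj_iff)
      then show ?thesis using assms(3) comp_of_self[OF assms(2)] by (simp add: avoids_def)
    qed simp
  qed
  then show ?thesis using comp_of_self[OF assms(2)] by (intro equalityI subsetI) auto
qed

lemma possible_indices_comp_of:
  fixes G :: "('v::linorder, 'h, 'e) tgraph"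
  assumes "fgraph G" "v \<in> verts G"
  shows "k \<in> possible_indices T G (comp_of G v) \<longleftrightarrow>
    (res_type G (comp_of G v), k) \<in> refined_types T \<and> (avoids G (internal G) v \<longrightarrow> k = vindex G v)"
proof -
  have 1: "internal (comp_graph G (comp_of G v)) = {} \<longleftrightarrow> avoids G (internal G) v"
    by (auto simp: comp_graph_simps avoids_def)
  have 2: "Min (comp_of G v) = v" if "avoids G (internal G) v"
    using comp_of_avoids_internal[OF assms that] by simp
  show ?thesis unfolding possible_indices_def mem_Collect_eq 1
    by (rule conj_cong[OF refl], rule imp_cong[OF refl]) (use 2 in auto)
qed

text \<open>Quantifies over vertices instead of components: vertices are shared by \<open>G\<close>,
  its covering subgraphs and, through roots, its contractions, while the component sets
  differ.\<close>

lemma specified_graphs_iff: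
  fixes G :: "('v::linorder, 'h, 'e) tgraph"
  shows "(G, i) \<in> specified_graphs T \<longleftrightarrow>
    tgraph G \<and> has_types_of T G \<and> locally_1PI G \<and> i \<in> extensional (pi0 G) \<and>
    (\<forall>v\<in>verts G. res_type G (comp_of G v) \<in> vertex_types T \<and>
      (res_type G (comp_of G v), i (comp_of G v)) \<in> refined_types T \<and>
      (avoids G (internal G) v \<longrightarrow> i (comp_of G v) = vindex G v))"
proof (cases "tgraph G")
  case True
  have "(\<forall>C\<in>pi0 G. i C \<in> possible_indices T G C) \<longleftrightarrow>
      (\<forall>v\<in>verts G. i (comp_of G v) \<in> possible_indices T G (comp_of G v))"
    by (simp add: pi0_def)
  moreover have "superficially_divergent T G \<longleftrightarrow> (\<forall>v\<in>verts G. res_type G (comp_of G v) \<in> vertex_types T)"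
    by (simp add: superficially_divergent_def pi0_def)
  ultimately show ?thesis
    using True by (auto simp: specified_graphs_def PiE_iff possible_indices_comp_of tgraph_fgraph)
qed (simp add: specified_graphs_def)

text \<open>When no edge of the component is cut, its paths persist in \<open>g\<close> and the two
  involutions agree on it; a cut edge would be internal in one component graph and not in the other.
  The comparison of component graphs thus becomes a condition on
  \<open>internal G - internal g\<close>.\<close>

lemma spec_subgraph_iff:
  fixes G :: "('v, 'h, 'e) tgraph"
  assumes "fgraph G"
  shows "spec_subgraph (g, j) (G, i) \<longleftrightarrow> covering_subgraph g G \<and>
    (\<forall>v\<in>verts G. avoids G (internal G - internal g) v \<longrightarrow> j (comp_of g v) = i (comp_of G v))"
proof (cases "covering_subgraph g G")
  case True
  note c = covering_subgraphD[OF True assms]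
  have full: "comp_of g v = comp_of G v" "comp_graph g (comp_of G v) = comp_graph G (comp_of G v)"
    if v: "v \<in> verts G" and av: "avoids G (internal G - internal g) v" for v
  proof -
    have "(v, w) \<in> (adj g)\<^sup>*" if "(v, w) \<in> (adj G)\<^sup>*" for w
      using that
    proof induction
      case (step y z)
      obtain h where h: "h \<in> internal G" "y = bd G h" "z = bd G (invol G h)"
        using step(2) by (auto simp: adj_iff)
      have "h \<in> internal g"
        using av h step(1) in_comp_of[OF assms v] by (auto simp: avoids_def)
      then have "(y, z) \<in> adj g"
        unfolding adj_iff using h c(4) c(7) by (intro bexI[of _ h]) simp_all
      with step(3) show ?case by (rule rtrancl_into_rtrancl)
    qed simp
    moreover have "(adj g)\<^sup>* \<subseteq> (adj G)\<^sup>*" by (rule rtrancl_mono[OF adj_covering_subgraph[OF True assms]])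
    ultimately show "comp_of g v = comp_of G v" unfolding comp_of_def c(2) by auto
    have "invol g h = invol G h" if "h \<in> halfs G" "bd G h \<in> comp_of G v" for h
      using that av c(3) c(7)[of h] by (cases "h \<in> internal g") (auto simp: avoids_def internal_def)
    then have "restrict (invol g) {h \<in> halfs G. bd G h \<in> comp_of G v} =
        restrict (invol G) {h \<in> halfs G. bd G h \<in> comp_of G v}"
      by (intro restrict_ext) auto
    then show "comp_graph g (comp_of G v) = comp_graph G (comp_of G v)"
      by (simp add: comp_graph_def Let_def c(3,4))
  qed
  have avoidsI: "avoids G (internal G - internal g) v"
    if "comp_graph g (comp_of G v) = comp_graph G (comp_of G v)" for v
    unfolding avoids_def
  proof (intro ballI notI)
    fix h assume h: "h \<in> internal G - internal g" "bd G h \<in> comp_of G v"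
    have "h \<in> internal (comp_graph G (comp_of G v))" using h by (simp add: comp_graph_simps)
    then have "h \<in> internal (comp_graph g (comp_of G v))" using that by simp
    then show False using h by (simp add: comp_graph_simps)
  qed
  show ?thesis
  proof
    assume "spec_subgraph (g, j) (G, i)"
    then have *: "j C = i C" if "C \<in> pi0 g" "C \<in> pi0 G" "comp_graph g C = comp_graph G C" for C
      using that by (simp add: spec_subgraph_def)
    have "j (comp_of g v) = i (comp_of G v)"
      if "v \<in> verts G" "avoids G (internal G - internal g) v" for v
      using *[of "comp_of G v"] full[OF that] comp_of_in_pi0[of v g] comp_of_in_pi0[of v G] that(1) c(2)
      by simp
    with True show "covering_subgraph g G \<and>
      (\<forall>v\<in>verts G. avoids G (internal G - internal g) v \<longrightarrow> j (comp_of g v) = i (comp_of G v))" by simp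
  next
    assume R: "covering_subgraph g G \<and>
      (\<forall>v\<in>verts G. avoids G (internal G - internal g) v \<longrightarrow> j (comp_of g v) = i (comp_of G v))"
    have "j C = i C" if C: "C \<in> pi0 g" "C \<in> pi0 G" "comp_graph g C = comp_graph G C" for C
    proof -
      obtain v where v: "v \<in> verts G" "C = comp_of G v" using C(2) by (rule pi0_cases)
      have av: "avoids G (internal G - internal g) v" using avoidsI C(3) v(2) by simp
      have "j (comp_of g v) = i (comp_of G v)" using R v(1) av by blast
      then show ?thesis using v(2) full(1)[OF v(1) av] by simp
    qed
    then show "spec_subgraph (g, j) (G, i)" using True by (simp add: spec_subgraph_def)
  qed
qed (simp add: spec_subgraph_def)

context covering
begin

lemma avoids_K:
  assumes "w \<in> verts K" "A \<subseteq> halfs K"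
  shows "avoids K A w \<longleftrightarrow> avoids G A w"
  using bd_K_comp_of[OF assms(1)] assms(2) by (auto simp: avoids_def)

lemma avoids_G_root: "v \<in> verts G \<Longrightarrow> avoids G A (root g v) \<longleftrightarrow> avoids G A v"
  by (simp add: avoids_def comp_of_G_root)

lemma comp_of_g_root: "v \<in> verts G \<Longrightarrow> comp_of g (root g v) = comp_of g v"
  using root_simps(3)[OF sub(1)] sub(2) by simp

lemma vindex_K: "w \<in> verts K \<Longrightarrow> vindex K w = j (comp_of g w)"
  by (simp add: contract_typed_simps)

end

section \<open>Contraction of specified graphs\<close>

text \<open>The involution of a covering subgraph is that of \<open>G\<close> on its internal
  half-edges and the identity on the others, so these half-edges determine it.\<close>

lemma covering_subgraph_eqI:
  assumes "fgraph G" "covering_subgraph g G" "covering_subgraph g' G" "internal g = internal g'"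
  shows "g = g'"
proof -
  note c = covering_subgraphD[OF assms(2,1)] and c' = covering_subgraphD[OF assms(3,1)]
  show ?thesis
  proof (rule fgraph_eqI[OF c(1) c'(1)])
    show "invol g h = invol g' h" if "h \<in> halfs g'" for h
    proof (cases "h \<in> internal g'")
      case True
      then show ?thesis using c(7)[of h] c'(7)[of h] assms(4) by simp
    next
      case False
      then have "h \<notin> internal g" using assms(4) by simp
      with False show ?thesis using that c(3) c'(3) by (simp add: internal_def)
    qed
  qed (simp_all add: c c')
qed

lemma contract_spec_eq:
  "contract_spec (G, i) (g, j) = (contract_typed G (g, j),
    \<lambda>C\<in>pi0 (contract_typed G (g, j)). i (comp_of G (Min C)))"
  by (simp add: contract_spec_def Let_def)

lemma fst_contract_spec: "fst (contract_spec (G, i) (g, j)) = contract_typed G (g, j)"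
  by (simp add: contract_spec_eq)

lemma snd_contract_spec_extensional:
  "snd (contract_spec (G, i) (g, j)) \<in> extensional (pi0 (contract_typed G (g, j)))"
  by (simp add: contract_spec_eq)

lemma extensional_pi0_eqI:
  assumes "a \<in> extensional (pi0 G)" "b \<in> extensional (pi0 G)"
    "\<And>v. v \<in> verts G \<Longrightarrow> a (comp_of G v) = b (comp_of G v)"
  shows "a = b"
  by (rule extensionalityI[OF assms(1,2)]) (auto simp: pi0_def assms(3))

text \<open>By \<open>root_K\<close>, the \<open>Min\<close> of a component of \<open>K\<close> is
  also the least vertex of the component of \<open>G\<close>, so \<open>contract_spec\<close> looks
  up the intended value of \<open>i\<close>.\<close>

lemma (in covering) snd_contract_spec:
  assumes "w \<in> verts K"
  shows "snd (contract_spec (G, i) (g, j)) (comp_of K w) = i (comp_of G w)"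
proof -
  have w: "w \<in> verts G" using assms verts_K_sub by auto
  have "comp_of G (Min (comp_of K w)) = comp_of G w"
    using root_K[OF assms] root_simps(3)[OF fG w] by (simp add: root_def)
  then show ?thesis using comp_of_in_pi0[OF assms] by (simp add: contract_spec_eq)
qed

lemma avoids_mono: "avoids G A v \<Longrightarrow> B \<subseteq> A \<Longrightarrow> avoids G B v"
  by (auto simp: avoids_def)

lemma avoids_covering_subgraph:
  assumes "covering_subgraph (g :: ('v::linorder, 'h, 'e) tgraph) G" "fgraph G" "v \<in> verts G" "avoids G A v"
  shows "avoids g A v"
proof -
  \<comment> \<open>The specification does not enter the facts about components, hence the
    dummy.\<close>
  interpret covering G g undefined using assms(1,2) by unfold_locales
  show ?thesis using comp_of_g_sub[OF assms(3)] assms(4) sub(4) by (auto simp: avoids_def)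
qed

lemma contract_spec_specified:
  fixes G g :: "('v::linorder, 'h, 'e) tgraph"
  assumes G: "(G, i) \<in> specified_graphs T" and g: "(g, j) \<in> specified_graphs T"
    and sub: "spec_subgraph (g, j) (G, i)"
  shows "contract_spec (G, i) (g, j) \<in> specified_graphs T"
proof -
  note sG = G[unfolded specified_graphs_iff] and sg = g[unfolded specified_graphs_iff]
  have tG: "tgraph G" using sG by simp
  have fG: "fgraph G" using tG by (rule tgraph_fgraph)
  note ss = sub[unfolded spec_subgraph_iff[OF fG]]
  interpret covering G g j using fG ss by unfold_locales simp_all
  let ?l = "snd (contract_spec (G, i) (g, j))"
  have vg: "w \<in> verts g" and vG: "w \<in> verts G" if "w \<in> verts K" for w
    using that verts_K_sub sub(2) by auto
  have "has_types_of T K"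
    unfolding has_types_of_def
  proof (intro conjI ballI)
    show "htype K h \<in> half_types T" if "h \<in> halfs K" for h
      using that sG by (auto simp: has_types_of_def contract_typed_simps)
    show "(star_type (htype K) K w, vindex K w) \<in> refined_types T" if "w \<in> verts K" for w
      using sg vg[OF that] by (simp add: star_type_K[OF that] vindex_K[OF that])
  qed
  \<comment> \<open>An isolated vertex of \<open>K\<close> stands for a component that
    \<open>g\<close> leaves whole, where \<open>spec_subgraph\<close> already forces
    \<open>j\<close> and \<open>i\<close> to agree.\<close>
  moreover have "?l (comp_of K w) = vindex K w" if "w \<in> verts K" "avoids K (internal K) w" for w
  proof -
    have "internal K \<subseteq> halfs K" using internal_halfs[of _ K] by auto
    then have "avoids G (internal G - internal g) w"
      using that(2) avoids_K[OF that(1)] internal_K by simp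
    then have "j (comp_of g w) = i (comp_of G w)" using ss vG[OF that(1)] by simp
    then show ?thesis using snd_contract_spec[OF that(1)] vindex_K[OF that(1)] by simp
  qed
  moreover have "?l \<in> extensional (pi0 K)" by (rule snd_contract_spec_extensional)
  moreover have "res_type K (comp_of K w) \<in> vertex_types T \<and>
      (res_type K (comp_of K w), ?l (comp_of K w)) \<in> refined_types T" if "w \<in> verts K" for w
    using sG vG[OF that] by (simp add: res_type_K[OF that] snd_contract_spec[OF that])
  moreover have "locally_1PI K" using sG by (intro locally_1PI_K) simp
  ultimately have "(K, ?l) \<in> specified_graphs T"
    unfolding specified_graphs_iff using tgraph_K[OF tG] by simp
  then show ?thesis using fst_contract_spec[of G i g j] by (metis prod.collapse)
qed

lemma specified_graphs_fgraph:
  fixes s :: "('v::linorder, 'h, 'e) spec_graph"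
  assumes "s \<in> specified_graphs T"
  shows "tgraph (fst s)" "fgraph (fst s)"
  using assms tgraph_fgraph by (auto simp: specified_graphs_def)

lemma theory_subgraphs_eq:
  assumes "s \<in> specified_graphs T"
  shows "theory_subgraphs T s = {r \<in> specified_graphs T. spec_subgraph r s}"
proof -
  have "contract_spec s r \<in> specified_graphs T" if "r \<in> specified_graphs T" "spec_subgraph r s" for r
    using contract_spec_specified[of "fst s" "snd s" T "fst r" "snd r"] assms that by simp
  then show ?thesis by (auto simp: theory_subgraphs_def)
qed

lemma finite_theory_subgraphs:
  fixes s :: "('v::linorder, 'h, 'e) spec_graph"
  assumes T: "qft T" and s: "s \<in> specified_graphs T"
  shows "finite (theory_subgraphs T s)"
proof -
  obtain G i where Gi: "s = (G, i)" by (cases s)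
  have fG: "fgraph G" using specified_graphs_fgraph(2)[OF s] Gi by simp
  \<comment> \<open>\<open>superficially_divergent\<close> is kept in \<open>?A\<close> because
    \<open>qft\<close> bounds the number of indices only over types in
    \<open>vertex_types\<close>.\<close>
  let ?A = "{g \<in> cut G ` Pow (internal G). fgraph g \<and> superficially_divergent T g}"
  let ?B = "\<lambda>g. \<Pi>\<^sub>E C\<in>pi0 g. possible_indices T g C"
  have "finite (internal G)" using fG by (simp add: fgraph_def internal_def)
  then have "finite ?A" by simp
  moreover have "finite (?B g)" if "g \<in> ?A" for g
  proof (rule finite_PiE)
    show "finite (pi0 g)" using that by (intro finite_pi0) simp
    show "finite (possible_indices T g C)" if "C \<in> pi0 g" for C
    proof (rule finite_subset)
      show "possible_indices T g C \<subseteq> {k. (res_type g C, k) \<in> refined_types T}"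
        by (auto simp: possible_indices_def)
      show "finite {k. (res_type g C, k) \<in> refined_types T}"
        using T that \<open>g \<in> ?A\<close> by (simp add: qft_def superficially_divergent_def)
    qed
  qed
  ultimately have "finite (Sigma ?A ?B)" by (rule finite_SigmaI)
  moreover have "theory_subgraphs T s \<subseteq> Sigma ?A ?B"
  proof
    fix r assume r: "r \<in> theory_subgraphs T s"
    obtain g j where gj: "r = (g, j)" by (cases r)
    have g: "(g, j) \<in> specified_graphs T" "covering_subgraph g G"
      using r gj Gi by (auto simp: theory_subgraphs_def spec_subgraph_def)
    then have "g \<in> cut G ` Pow (internal G)" by (auto simp: covering_subgraph_def)
    then show "r \<in> Sigma ?A ?B"
      using g specified_graphs_fgraph[OF g(1)] gj by (simp add: specified_graphs_def)
  qed
  ultimately show ?thesis by (rule rev_finite_subset)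
qed

section \<open>Nested covering subgraphs and the exchange of the two summations\<close>

lemma spec_subgraph_trans:
  fixes G :: "('v::linorder, 'h, 'e) tgraph"
  assumes "fgraph G" and qr: "spec_subgraph (q, j) (r, k)" and rG: "spec_subgraph (r, k) (G, i)"
  shows "spec_subgraph (q, j) (G, i)"
proof -
  note rG' = rG[unfolded spec_subgraph_iff[OF assms(1)]]
  have cr: "covering_subgraph r G" using rG' by simp
  note r = covering_subgraphD[OF cr assms(1)]
  note qr' = qr[unfolded spec_subgraph_iff[OF r(1)]]
  have cq: "covering_subgraph q r" using qr' by simp
  note q = covering_subgraphD[OF cq r(1)]
  show ?thesis
    unfolding spec_subgraph_iff[OF assms(1)]
  proof (intro conjI ballI impI)
    show "covering_subgraph q G" using cq cr assms(1) by (rule covering_subgraph_trans)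
    fix v assume v: "v \<in> verts G" and av: "avoids G (internal G - internal q) v"
    \<comment> \<open>A component of \<open>G\<close> that \<open>q\<close> leaves whole is left
      whole by the intermediate \<open>r\<close> too, since \<open>r\<close> has every internal edge
      of \<open>q\<close>.\<close>
    have "avoids G (internal G - internal r) v" by (rule avoids_mono[OF av]) (use q(6) in auto)
    then have 1: "k (comp_of r v) = i (comp_of G v)" using rG' v by simp
    \<comment> \<open>Components of \<open>r\<close> lie inside those of \<open>G\<close>, so the
      condition also passes to \<open>q\<close> as a subgraph of \<open>r\<close>.\<close>
    have "avoids r (internal r - internal q) v"
      by (rule avoids_mono[OF avoids_covering_subgraph[OF cr assms(1) v av]]) (use r(6) in auto)
    then have "j (comp_of q v) = k (comp_of r v)" using qr' v r(2) by simp
    with 1 show "j (comp_of q v) = i (comp_of G v)" by simp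
  qed
qed

text \<open>Two contractions of the same \<open>q\<close> in parallel: \<open>R\<close> inside
  \<open>r\<close> and \<open>Q\<close> inside \<open>G\<close>. The vertices of both are the roots
  of \<open>q\<close>, which is what makes \<open>R.K\<close> a covering subgraph of
  \<open>Q.K\<close>.\<close>

locale tower =
  fixes q r G :: "('v::linorder, 'h, 'e) tgraph" and j :: "'v set \<Rightarrow> nat"
  assumes fG': "fgraph G" and rG: "covering_subgraph r G" and qr: "covering_subgraph q r"
begin

lemma fr: "fgraph r"
  using covering_subgraphD(1)[OF rG fG'] .

lemma qG: "covering_subgraph q G"
  using covering_subgraph_trans[OF qr rG fG'] .

sublocale R: covering r q j
  using fr qr by unfold_locales

sublocale Q: covering G q j
  using fG' qG by unfold_locales

lemma verts_K_eq: "verts R.K = verts Q.K"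
  by (simp add: contract_typed_simps)

lemma covering_subgraph_K: "covering_subgraph R.K Q.K"
proof (rule covering_subgraphI[OF R.fgraph_K Q.fgraph_K])
  note r = covering_subgraphD[OF rG fG'] and t = covering_subgraph_types[OF rG fG']
  show "halfs R.K = halfs Q.K" "bd R.K = bd Q.K" by (simp_all add: contract_typed_simps r)
  show "fgraph.more R.K = fgraph.more Q.K"
    by (simp add: tgraph_more_eq_iff contract_typed_simps r t)
  show "invol R.K h = invol Q.K h" if "h \<in> internal R.K" for h
    using that r(3,6,7) R.internal_K internal_halfs[OF that] internal_halfs[of h G]
    by (auto simp: contract_typed_simps)
qed (rule verts_K_eq)

lemma internal_diff_K: "internal Q.K - internal R.K = internal G - internal r"
  using R.sub(6) by (auto simp: R.internal_K Q.internal_K)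

text \<open>By \<open>internal_diff_K\<close> the same edges are cut at both levels, so whether a
  component is left whole can be tested before contraction.\<close>

lemma spec_subgraph_K:
  assumes "spec_subgraph (r, k) (G, i)"
  shows "spec_subgraph (contract_spec (r, k) (q, j)) (contract_spec (G, i) (q, j))"
proof -
  let ?a = "snd (contract_spec (r, k) (q, j))" and ?b = "snd (contract_spec (G, i) (q, j))"
  have "spec_subgraph (R.K, ?a) (Q.K, ?b)"
    unfolding spec_subgraph_iff[OF Q.fgraph_K] internal_diff_K
  proof (intro conjI ballI impI covering_subgraph_K)
    fix w assume w: "w \<in> verts Q.K" and av: "avoids Q.K (internal G - internal r) w"
    have "internal G - internal r \<subseteq> halfs Q.K"
      using internal_halfs[of _ Q.K] unfolding internal_diff_K[symmetric] by auto
    then have "avoids G (internal G - internal r) w" using av Q.avoids_K[OF w] by simp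
    moreover have "w \<in> verts G" using w Q.verts_K_sub by auto
    ultimately have "k (comp_of r w) = i (comp_of G w)"
      using assms unfolding spec_subgraph_iff[OF fG'] by simp
    then show "?a (comp_of R.K w) = ?b (comp_of Q.K w)"
      using R.snd_contract_spec[of w k] Q.snd_contract_spec[OF w, of i] w verts_K_eq by simp
  qed
  then show ?thesis using fst_contract_spec by (metis prod.collapse)
qed

text \<open>\<open>X\<close> is the second of the two contractions, \<open>Y\<close> the contraction
  in one step. Names agree because \<open>root R.K\<close> equals \<open>root r\<close> on roots of
  \<open>q\<close>; vertex indices agree because the specification of \<open>r/q\<close> takes its
  value at \<open>w\<close> from \<open>k\<close> at the component of \<open>w\<close> in
  \<open>r\<close>.\<close>

lemma contract_contract:
  "contract_spec (contract_spec (G, i) (q, j)) (contract_spec (r, k) (q, j)) = contract_spec (G, i) (r, k)"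
proof -
  let ?a = "snd (contract_spec (r, k) (q, j))" and ?b = "snd (contract_spec (G, i) (q, j))"
  interpret X: covering Q.K R.K ?a
    using Q.fgraph_K covering_subgraph_K by unfold_locales
  interpret Y: covering G r k
    using fG' rG by unfold_locales
  have v: "root R.K ` verts R.K = root r ` verts r"
  proof -
    have "root R.K ` verts R.K = root r ` verts R.K"
      by (rule image_cong[OF refl]) (rule R.root_K)
    moreover have "root r v \<in> root r ` verts R.K" if "v \<in> verts r" for v
      using R.root_G_in_verts_K[OF that] root_simps(4)[OF fr that] by (metis imageI)
    ultimately show ?thesis using R.verts_K_sub by auto
  qed
  have h: "halfs G - internal q - internal R.K = halfs G - internal r"
    using R.sub(6) by (auto simp: R.internal_K)
  have hsub: "h \<in> halfs G - internal q" if "h \<in> halfs G - internal r" for h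
    using that R.sub(6) by auto
  have K: "X.K = Y.K"
  proof (rule tgraph.equality)
    show "verts X.K = verts Y.K" 
      unfolding contract_typed_simps(1)[of Q.K] contract_typed_simps(1)[of G] by (rule v)
    show "halfs X.K = halfs Y.K" by (simp add: contract_typed_simps(2) h)
    show "invol X.K = invol Y.K"
      unfolding contract_typed_simps(2,3) h using hsub by (intro restrict_ext) simp
    show "htype X.K = htype Y.K"
      unfolding contract_typed_simps(2,5) h using hsub by (intro restrict_ext) simp
    have bd: "root R.K (root q (bd G h)) = root r (bd G h)" if "h \<in> halfs G - internal r" for h
    proof -
      have b: "bd G h \<in> verts r" using that fgraph_bd[OF fG'] Y.sub(2) by simp
      show ?thesis
        using R.root_K[OF R.root_in_verts_K[OF b]] R.comp_of_G_root[OF b] by (simp add: root_def)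
    qed
    show "bd X.K = bd Y.K"
      unfolding contract_typed_simps(2,4) h using hsub bd by (intro restrict_ext) simp
    have "?a (comp_of R.K w) = k (comp_of r w)" if "w \<in> root r ` verts r" for w
    proof (rule R.snd_contract_spec)
      show "w \<in> verts R.K" using that R.root_G_in_verts_K by auto
    qed
    then show "vindex X.K = vindex Y.K"
      unfolding contract_typed_simps(6)[of Q.K] contract_typed_simps(6)[of G] v
      by (intro restrict_ext)
  qed simp
  let ?l = "snd (contract_spec (Q.K, ?b) (R.K, ?a))"
  have "?l = snd (contract_spec (G, i) (r, k))"
  proof (rule extensional_pi0_eqI)
    show "?l \<in> extensional (pi0 Y.K)"
      using snd_contract_spec_extensional[of Q.K ?b R.K ?a] unfolding K .
    show "snd (contract_spec (G, i) (r, k)) \<in> extensional (pi0 Y.K)"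
      by (rule snd_contract_spec_extensional)
    fix w assume w: "w \<in> verts Y.K"
    then have wX: "w \<in> verts X.K" using K by simp
    then have wQ: "w \<in> verts Q.K" using X.verts_K_sub by auto
    have "?l (comp_of Y.K w) = ?b (comp_of Q.K w)"
      using X.snd_contract_spec[OF wX, of ?b] unfolding K .
    also have "\<dots> = i (comp_of G w)" using wQ by (rule Q.snd_contract_spec)
    also have "\<dots> = snd (contract_spec (G, i) (r, k)) (comp_of Y.K w)"
      using Y.snd_contract_spec[OF w] by simp
    finally show "?l (comp_of Y.K w) = snd (contract_spec (G, i) (r, k)) (comp_of Y.K w)" .
  qed
  moreover have "fst (contract_spec (Q.K, ?b) (R.K, ?a)) = fst (contract_spec (G, i) (r, k))"
    unfolding fst_contract_spec K ..
  ultimately have "contract_spec (Q.K, ?b) (R.K, ?a) = contract_spec (G, i) (r, k)"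
    by (intro prod_eqI)
  moreover have "(Q.K, ?b) = contract_spec (G, i) (q, j)" "(R.K, ?a) = contract_spec (r, k) (q, j)"
    using fst_contract_spec by (metis prod.collapse)+
  ultimately show ?thesis by simp
qed

end

text \<open>\<open>internal r\<close> is recovered as the edges of \<open>q\<close> together with
  those of the contraction, and \<open>k\<close> from its values at the roots of \<open>q\<close>,
  of which every component of \<open>r\<close> contains one.\<close>

lemma contract_spec_inj:
  fixes G q :: "('v::linorder, 'h, 'e) tgraph"
  assumes G: "fgraph G" and r: "(r, k) \<in> specified_graphs T" "covering_subgraph r G" "covering_subgraph q r"
    and r': "(r', k') \<in> specified_graphs T" "covering_subgraph r' G" "covering_subgraph q r'"
    and eq: "contract_spec (r, k) (q, j) = contract_spec (r', k') (q, j)"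
  shows "(r, k) = (r', k')"
proof -
  interpret t: tower q r G j using G r by unfold_locales
  interpret t': tower q r' G j using G r' by unfold_locales
  have K: "contract_typed r (q, j) = contract_typed r' (q, j)"
    using arg_cong[OF eq, of fst] unfolding fst_contract_spec .
  have "internal r - internal q = internal r' - internal q"
    using arg_cong[OF K, of internal] unfolding t.R.internal_K t'.R.internal_K .
  then have "internal r = internal r'" using t.R.sub(6) t'.R.sub(6) by blast
  then have "r = r'" using covering_subgraph_eqI[OF G r(2) r'(2)] by simp
  moreover have "k = k'"
  proof (rule extensional_pi0_eqI)
    show "k \<in> extensional (pi0 r)" "k' \<in> extensional (pi0 r)"
      using r(1) r'(1) \<open>r = r'\<close> by (simp_all add: specified_graphs_iff)
    fix v assume v: "v \<in> verts r"
    have w: "root q v \<in> verts t.R.K" using v by (rule t.R.root_in_verts_K)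
    have "k (comp_of r (root q v)) = k' (comp_of r (root q v))"
      using t.R.snd_contract_spec[OF w, of k] t'.R.snd_contract_spec[of "root q v" k'] w eq K \<open>r = r'\<close>
      by simp
    then show "k (comp_of r v) = k' (comp_of r v)" using t.R.comp_of_G_root[OF v] by simp
  qed
  ultimately show ?thesis by simp
qed

text \<open>The witness \<open>R\<close> is obtained from \<open>G\<close> by cutting the edges that are cut in \<open>H\<close>; its components
  carry the specifications of the corresponding components of \<open>H\<close>.\<close>

lemma contract_spec_surj:
  fixes G q H :: "('v::linorder, 'h, 'e) tgraph"
  assumes G: "(G, i) \<in> specified_graphs T" and q: "(q, j) \<in> specified_graphs T"
    and H: "(H, l) \<in> specified_graphs T"
    and qG: "spec_subgraph (q, j) (G, i)" and HK: "spec_subgraph (H, l) (contract_spec (G, i) (q, j))"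
  obtains R k where "(R, k) \<in> specified_graphs T" "spec_subgraph (R, k) (G, i)"
    "spec_subgraph (q, j) (R, k)" "contract_spec (R, k) (q, j) = (H, l)"
proof -
  note sG = G[unfolded specified_graphs_iff] and sq = q[unfolded specified_graphs_iff]
    and sH = H[unfolded specified_graphs_iff]
  have tG: "tgraph G" using sG by simp
  have fG: "fgraph G" using tG by (rule tgraph_fgraph)
  have cq: "covering_subgraph q G" using qG unfolding spec_subgraph_iff[OF fG] by simp
  interpret Q: covering G q j using fG cq by unfold_locales
  define b where "b = snd (contract_spec (G, i) (q, j))"
  have eq: "contract_spec (G, i) (q, j) = (Q.K, b)"
    unfolding b_def fst_contract_spec[symmetric, of G q j i] by (rule prod.collapse[symmetric])
  have HK': "covering_subgraph H Q.K"
      "\<And>w. w \<in> verts Q.K \<Longrightarrow> avoids Q.K (internal Q.K - internal H) w \<Longrightarrow> l (comp_of H w) = b (comp_of Q.K w)"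
    using HK unfolding eq spec_subgraph_iff[OF Q.fgraph_K] by simp_all
  note cH = covering_subgraphD[OF HK'(1) Q.fgraph_K]
  let ?S = "internal Q.K - internal H"
  define R where "R = cut G ?S"
  have inv: "invol G ` ?S \<subseteq> ?S"
  proof (rule image_subsetI)
    fix h assume h: "h \<in> ?S"
    then have hK: "h \<in> halfs Q.K" using internal_halfs[of h Q.K] by simp
    show "invol G h \<in> ?S"
      using h covering_subgraph_invol_mem[OF HK'(1) Q.fgraph_K hK] internal_invol[OF Q.fgraph_K, of h]
        Q.invol_K[OF hK] by simp
  qed
  have SG: "?S \<subseteq> internal G" by (auto simp: Q.internal_K)
  have RG: "covering_subgraph R G"
    unfolding covering_subgraph_def R_def by (rule exI[of _ ?S], intro conjI SG inv refl)
  \<comment> \<open>Cutting \<open>?S\<close> keeps exactly the edges of \<open>q\<close> and of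
    \<open>H\<close>; the choice is forced if contracting \<open>q\<close> in \<open>R\<close> is to
    give \<open>H\<close>.\<close>
  have iR: "internal R = internal q \<union> internal H"
    using Q.sub(6) cH(6) by (auto simp: R_def Q.internal_K)
  have qR: "covering_subgraph q R"
    by (rule covering_subgraph_mid[OF cq RG fG]) (simp add: iR)
  interpret t: tower q R G j using fG RG qR by unfold_locales
  have disj: "internal q \<inter> internal H = {}" using cH(6) Q.internal_K by auto
  have KH: "t.R.K = H"
  proof (rule covering_subgraph_eqI[OF Q.fgraph_K t.covering_subgraph_K HK'(1)])
    show "internal t.R.K = internal H" using disj by (auto simp: t.R.internal_K iR)
  qed
  have GR: "verts R = verts G" "halfs R = halfs G" "bd R = bd G" "htype R = htype G" "vindex R = vindex G"
    by (simp_all add: R_def) (simp_all add: cut_def)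
  define k where "k = (\<lambda>C\<in>pi0 R. l (comp_of H (Min C)))"
  have k: "k (comp_of R w) = l (comp_of H w)" if "w \<in> verts H" for w
  proof -
    have w: "w \<in> verts t.R.K" using that KH by simp
    then have "w \<in> verts R" using t.R.verts_K_sub by auto
    then have "k (comp_of R w) = l (comp_of H (root R w))"
      by (simp add: k_def root_def comp_of_in_pi0)
    also have "root R w = root H w" using t.R.root_K[OF w] KH by simp
    also have "comp_of H (root H w) = comp_of H w" using root_simps(3)[OF cH(1) that] .
    finally show ?thesis .
  qed
  have w: "root q v \<in> verts H" "comp_of R (root q v) = comp_of R v"
      "comp_of q (root q v) = comp_of q v" "root q v \<in> verts R"
    if "v \<in> verts R" for v
    using t.R.root_in_verts_K[OF that] t.R.comp_of_G_root[OF that] t.R.comp_of_g_root[OF that]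
      t.R.verts_K_sub KH by auto
  have hH: "internal H \<subseteq> halfs t.R.K" using internal_halfs[of _ H] KH by auto
  \<comment> \<open>If no edge of \<open>H\<close> meets the component of \<open>v\<close>, the
    corresponding vertex of \<open>H\<close> is isolated. Its specification must then be its own
    vertex index, which the contraction took from \<open>j\<close>.\<close>
  have fin: "l (comp_of H (root q v)) = j (comp_of q (root q v))"
    if v: "v \<in> verts R" and av: "avoids R (internal H) v" for v
  proof -
    have "avoids R (internal H) (root q v)" using av t.R.avoids_G_root[OF v] by simp
    then have "avoids H (internal H) (root q v)"
      using t.R.avoids_K[OF _ hH] w(1)[OF v] KH by simp
    then show ?thesis
      using sH w(1)[OF v] t.R.vindex_K[of "root q v"] KH by simp
  qed
  have "(R, k) \<in> specified_graphs T"
    unfolding specified_graphs_iff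
  proof (intro conjI ballI impI)
    show "tgraph R" using RG tG by (rule covering_subgraph_tgraph)
    show "has_types_of T R"
      using sG by (simp add: has_types_of_def GR star_type_def star_def)
    show "locally_1PI R"
      using sq sH KH by (intro t.R.locally_1PI_extension) simp_all
    show "k \<in> extensional (pi0 R)" by (simp add: k_def)
    fix v assume v: "v \<in> verts R"
    have res: "res_type R (comp_of R v) = res_type H (comp_of H (root q v))"
      using t.R.res_type_K[of "root q v"] w(1,2)[OF v] KH by simp
    have kv: "k (comp_of R v) = l (comp_of H (root q v))"
      using k[OF w(1)[OF v]] w(2)[OF v] by simp
    show "res_type R (comp_of R v) \<in> vertex_types T"
      using sH w(1)[OF v] res by simp
    show "(res_type R (comp_of R v), k (comp_of R v)) \<in> refined_types T"
      using sH w(1)[OF v] res kv by simp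
    \<comment> \<open>At an isolated vertex the value of \<open>k\<close> is traced to
      \<open>l\<close>, then to \<open>j\<close>, and then to the vertex index, which cutting leaves
      unchanged.\<close>
    assume av: "avoids R (internal R) v"
    have "root q v \<in> comp_of R v" using comp_of_self[OF w(4)[OF v]] w(2)[OF v] by simp
    then have root: "root q v = v" using comp_of_avoids_internal[OF t.fr v av] by simp
    have "avoids R (internal H) v" by (rule avoids_mono[OF av]) (simp add: iR)
    then have "k (comp_of R v) = j (comp_of q v)" using fin[OF v] kv root by simp
    also have "avoids q (internal q) v"
      by (rule avoids_mono[OF avoids_covering_subgraph[OF qR t.fr v av]]) (simp add: iR)
    then have "j (comp_of q v) = vindex q v" using sq v t.R.sub(2) by simp
    also have "vindex q v = vindex R v" using covering_subgraph_types(2)[OF qR t.fr] by simp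
    finally show "k (comp_of R v) = vindex R v" .
  qed
  moreover have "spec_subgraph (R, k) (G, i)"
    unfolding spec_subgraph_iff[OF fG]
  proof (intro conjI ballI impI RG)
    fix v assume vG: "v \<in> verts G" and av: "avoids G (internal G - internal R) v"
    have v: "v \<in> verts R" using vG GR by simp
    have wK: "root q v \<in> verts Q.K" using vG by (rule Q.root_in_verts_K)
    have S: "internal G - internal R = ?S" using Q.internal_K iR by auto
    have "avoids G ?S (root q v)" using av Q.avoids_G_root[OF vG] S by simp
    moreover have "?S \<subseteq> halfs Q.K" using internal_halfs[of _ Q.K] by auto
    ultimately have "avoids Q.K ?S (root q v)" using Q.avoids_K[OF wK] by simp
    then have "l (comp_of H (root q v)) = i (comp_of G (root q v))"
      using HK'(2)[OF wK] Q.snd_contract_spec[OF wK, of i] by (simp add: b_def)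
    then show "k (comp_of R v) = i (comp_of G v)"
      using k[OF w(1)[OF v]] w(2)[OF v] Q.comp_of_G_root[OF vG] by simp
  qed
  moreover have "spec_subgraph (q, j) (R, k)"
    unfolding spec_subgraph_iff[OF t.fr]
  proof (intro conjI ballI impI qR)
    fix v assume v: "v \<in> verts R" and "avoids R (internal R - internal q) v"
    moreover have "internal R - internal q = internal H" using iR disj by auto
    ultimately have "l (comp_of H (root q v)) = j (comp_of q (root q v))" using fin by simp
    then show "j (comp_of q v) = k (comp_of R v)"
      using k[OF w(1)[OF v]] w(2,3)[OF v] by simp
  qed
  moreover have "contract_spec (R, k) (q, j) = (H, l)"
  proof (rule prod_eqI)
    show "fst (contract_spec (R, k) (q, j)) = fst (H, l)" by (simp add: fst_contract_spec KH)
    have "snd (contract_spec (R, k) (q, j)) = l"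
    proof (rule extensional_pi0_eqI)
      show "snd (contract_spec (R, k) (q, j)) \<in> extensional (pi0 H)"
        using snd_contract_spec_extensional[of R k q j] KH by simp
      show "l \<in> extensional (pi0 H)" using sH by simp
      fix v assume v: "v \<in> verts H"
      then show "snd (contract_spec (R, k) (q, j)) (comp_of H v) = l (comp_of H v)"
        using t.R.snd_contract_spec[of v k] k[OF v] KH by simp
    qed
    then show "snd (contract_spec (R, k) (q, j)) = snd (H, l)" by simp
  qed
  ultimately show ?thesis by (rule that)
qed

lemma bij_betw_contract_spec:
  fixes s :: "('v::linorder, 'h, 'e) spec_graph"
  assumes s: "s \<in> specified_graphs T"
  shows "bij_betw (\<lambda>(r, q). (q, contract_spec r q))
    (SIGMA r:theory_subgraphs T s. theory_subgraphs T r)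
    (SIGMA q:theory_subgraphs T s. theory_subgraphs T (contract_spec s q))"
    (is "bij_betw ?f ?A ?B")
proof -
  obtain G i where Gi: "s = (G, i)" by (cases s)
  have fG: "fgraph G" using specified_graphs_fgraph(2)[OF s] Gi by simp
  have A: "(r, q) \<in> ?A \<longleftrightarrow> r \<in> specified_graphs T \<and> q \<in> specified_graphs T \<and>
      spec_subgraph r s \<and> spec_subgraph q r" for r q
    using theory_subgraphs_eq[OF s] theory_subgraphs_eq[of r T] by auto
  have B: "(q, t) \<in> ?B \<longleftrightarrow> q \<in> specified_graphs T \<and> t \<in> specified_graphs T \<and>
      spec_subgraph q s \<and> spec_subgraph t (contract_spec s q)" for q t
    using theory_subgraphs_eq[OF s] theory_subgraphs_eq[of "contract_spec s q" T]
    by (auto simp: theory_subgraphs_def[of T s])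
  have tower: "tower q r G" if "((r, k), (q, j)) \<in> ?A" for r k q j
  proof -
    have "covering_subgraph r G" "covering_subgraph q r"
      using that Gi unfolding A by (simp_all add: spec_subgraph_def)
    then show ?thesis using fG by unfold_locales
  qed
  have "inj_on ?f ?A"
  proof (rule inj_onI)
    fix x y assume xy: "x \<in> ?A" "y \<in> ?A" "?f x = ?f y"
    obtain r k q j where x: "x = ((r, k), (q, j))" by (metis prod.exhaust)
    obtain r' k' q' j' where y: "y = ((r', k'), (q', j'))" by (metis prod.exhaust)
    have q: "q' = q" "j' = j" using xy(3) by (simp_all add: x y)
    have eq: "contract_spec (r, k) (q, j) = contract_spec (r', k') (q, j)"
      using xy(3) unfolding x y q by simp
    interpret t: tower q r G j using xy(1) unfolding x by (rule tower)
    interpret t': tower q r' G j using xy(2) unfolding y q by (rule tower)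
    have "(r, k) = (r', k')"
      using xy(1,2) unfolding x y q A
      by (intro contract_spec_inj[where T = T, OF fG _ t.rG t.qr _ t'.rG t'.qr eq]) simp_all
    then show "x = y" by (simp add: x y q)
  qed
  moreover have "?f ` ?A \<subseteq> ?B"
  proof (rule image_subsetI)
    fix x assume xA: "x \<in> ?A"
    obtain r k q j where x: "x = ((r, k), (q, j))" by (metis prod.exhaust)
    interpret t: tower q r G j using xA unfolding x by (rule tower)
    note a = xA[unfolded x A, unfolded Gi]
    have "spec_subgraph (q, j) (G, i)" using a by (intro spec_subgraph_trans[OF fG, of q j r k]) simp_all
    moreover have "contract_spec (r, k) (q, j) \<in> specified_graphs T"
      using a by (intro contract_spec_specified) simp_all
    moreover have "spec_subgraph (contract_spec (r, k) (q, j)) (contract_spec (G, i) (q, j))"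
      using a by (intro t.spec_subgraph_K) simp
    ultimately show "?f x \<in> ?B" using a unfolding x prod.case B unfolding Gi by simp
  qed
  moreover have "?B \<subseteq> ?f ` ?A"
  proof
    fix x assume xB: "x \<in> ?B"
    obtain q j H l where x: "x = ((q, j), (H, l))" by (metis prod.exhaust)
    note b = xB[unfolded x B, unfolded Gi]
    obtain R k where R: "(R, k) \<in> specified_graphs T" "spec_subgraph (R, k) (G, i)"
        "spec_subgraph (q, j) (R, k)" "contract_spec (R, k) (q, j) = (H, l)"
      using contract_spec_surj[of G i T q j H l] b s[unfolded Gi] by blast
    have "((R, k), (q, j)) \<in> ?A" unfolding A unfolding Gi using R b by simp
    then show "x \<in> ?f ` ?A" by (rule rev_image_eqI) (simp add: x R(4))
  qed
  ultimately show ?thesis unfolding bij_betw_def by (intro conjI equalityI)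
qed

section \<open>Momenta and the convolution product\<close>

lemma halfs_contract: "halfs (contract G g) = halfs G - internal g"
  by (simp add: contract_def Let_def)

lemma momentum_space_covering_subgraph:
  assumes "covering_subgraph g G" "fgraph G" "p \<in> momentum_space G"
  shows "p \<in> momentum_space g"
  using assms(3) covering_subgraphD[OF assms(1,2)]
  by (auto simp: momentum_space_def star_def)

text \<open>Momentum is conserved at a contracted component because the momenta of its internal edges
  cancel in pairs.\<close>

lemma (in covering) restr_momentum_space:
  assumes p: "p \<in> momentum_space G"
  shows "restr (halfs K) p \<in> momentum_space K"
proof -
  have "(\<Sum>h\<in>star K w. restr (halfs K) p h) = 0" if w: "w \<in> verts K" for w
  proof -
    let ?C = "comp_of g w"
    let ?I = "{h \<in> internal g. bd g h \<in> ?C}"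
    have wg: "w \<in> verts g" using w verts_K_sub sub(2) by auto
    have fin: "finite (halfs G)" "finite ?C" using fG finite_comp_of[OF sub(1)] by (simp_all add: fgraph_def)
    have finI: "finite ?I" using fin(1) by (rule finite_subset[rotated]) (auto simp: internal_def sub(3))
    have "(\<Sum>h\<in>{h \<in> halfs G. bd G h \<in> ?C}. p h) = (\<Sum>v\<in>?C. \<Sum>h\<in>star G v. p h)"
    proof -
      have "(\<Sum>h\<in>{h \<in> halfs G. bd G h \<in> ?C}. p h) =
          (\<Sum>v\<in>?C. \<Sum>h\<in>{h \<in> {h \<in> halfs G. bd G h \<in> ?C}. bd G h = v}. p h)"
        using fin by (intro sum.group[symmetric]) auto
      also have "\<dots> = (\<Sum>v\<in>?C. \<Sum>h\<in>star G v. p h)"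
        by (intro sum.cong) (auto simp: star_def)
      finally show ?thesis .
    qed
    also have "\<dots> = 0"
    proof (rule sum.neutral, rule ballI)
      fix v assume "v \<in> ?C"
      then have "v \<in> verts G" using comp_of_vertsD[of v g w] sub(2) by simp
      then show "(\<Sum>h\<in>star G v. p h) = 0" using p by (simp add: momentum_space_def)
    qed
    finally have total: "(\<Sum>h\<in>{h \<in> halfs G. bd G h \<in> ?C}. p h) = 0" .
    have "(\<Sum>h\<in>?I. p h) = 0"
    proof -
      have inv: "invol g h \<in> ?I" "invol g (invol g h) = h" if "h \<in> ?I" for h
      proof -
        have h: "h \<in> internal g" "h \<in> halfs g" "bd g h \<in> ?C" using that internal_halfs[of h g] by simp_all
        have "bd g (invol g h) \<in> ?C"
          using comp_of_bd_invol[OF sub(1) h(2)] comp_of_eqI[OF sub(1) wg h(3)]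
            comp_of_self[OF fgraph_bd[OF sub(1) fgraph_invol(1)[OF sub(1) h(2)]]] by simp
        then show "invol g h \<in> ?I" using internal_invol[OF sub(1) h(1)] by simp
        show "invol g (invol g h) = h" using fgraph_invol(2)[OF sub(1) h(2)] .
      qed
      have "(\<Sum>h\<in>?I. p h) = (\<Sum>h\<in>?I. p (invol g h))"
        by (rule sum.reindex_bij_witness[of _ "invol g" "invol g"]) (use inv in auto)
      also have "\<dots> = (\<Sum>h\<in>?I. - p h)"
      proof (rule sum.cong[OF refl])
        fix h assume "h \<in> ?I"
        then have "h \<in> internal G" "invol g h = invol G h" using sub(6,7) by auto
        then have "p h + p (invol g h) = 0" using p by (simp add: momentum_space_def)
        then show "p (invol g h) = - p h" by (simp add: eq_neg_iff_add_eq_0 add.commute)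
      qed
      finally have "(\<Sum>h\<in>?I. p h) = - (\<Sum>h\<in>?I. p h)" unfolding sum_negf .
      then have "(\<Sum>h\<in>?I. p h) + (\<Sum>h\<in>?I. p h) = 0" by (rule eq_neg_iff_add_eq_0[THEN iffD1])
      then have "2 *\<^sub>R (\<Sum>h\<in>?I. p h) = 0" unfolding scaleR_2 .
      then show ?thesis unfolding scaleR_eq_0_iff by simp
    qed
    moreover have "{h \<in> halfs G. bd G h \<in> ?C} = star K w \<union> ?I" "star K w \<inter> ?I = {}"
      using sub(3,4) internal_halfs[of _ g] by (auto simp: star_K[OF w] halfs_K)
    moreover have "finite (star K w)" using fin(1) by (simp add: star_K[OF w] contract_typed_simps(2))
    ultimately have "(\<Sum>h\<in>star K w. p h) = 0"
      using total finI by (simp add: sum.union_disjoint)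
    moreover have "(\<Sum>h\<in>star K w. restr (halfs K) p h) = (\<Sum>h\<in>star K w. p h)"
      by (rule sum.cong) (auto simp: restr_def star_def)
    ultimately show ?thesis by simp
  qed
  moreover have "restr (halfs K) p h + restr (halfs K) p (invol K h) = 0" if "h \<in> internal K" for h
  proof -
    have "h \<in> halfs K" using that by (rule internal_halfs)
    then show ?thesis
      using that p invol_halfs_K[of h] internal_K by (simp add: restr_def invol_K momentum_space_def)
  qed
  moreover have "restr (halfs K) p h = 0" if "h \<notin> halfs K" for h
    using that by (simp add: restr_def)
  ultimately show ?thesis unfolding momentum_space_def by blast
qed

section \<open>Associativity at a single specified graph\<close>

lemma at_graph_conv: "at_graph (conv T \<phi> \<eta>) s = conv_at T \<phi> \<eta> s"
  by (simp add: at_graph_def conv_def)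

lemma conv_gen: "conv T \<phi> \<eta> (gen (G, i)) = (\<lambda>G' p. if G' = G then conv_at T \<phi> \<eta> (G, i) p else 0)"
  by (intro ext) (simp add: conv_def)

lemma conv_at_outside:
  "p \<notin> momentum_space (fst s) \<Longrightarrow> conv_at T \<phi> \<eta> s p = 0"
  by (simp add: conv_at_def pull_sub_def)

lemma conv_at_inside:
  assumes "p \<in> momentum_space (fst s)"
  shows "conv_at T \<phi> \<eta> s p = (\<Sum>r\<in>theory_subgraphs T s. at_graph \<phi> r p *
    at_graph \<eta> (contract_spec s r) (restr (halfs (fst s) - internal (fst r)) p))"
  using assms by (simp add: conv_at_def pull_sub_def pull_contract_def halfs_contract)

lemma restr_restr: "restr A (restr B p) = restr (A \<inter> B) p"
  by (auto simp: restr_def)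

lemma conv_at_assoc:
  fixes s :: "('v::linorder, 'h, 'e) spec_graph"
    and \<phi> \<eta> \<xi> :: "('v, 'h, 'e, 'd::finite) graph_map"
  assumes T: "qft T" and s: "s \<in> specified_graphs T"
  shows "conv_at T (conv T \<phi> \<eta>) \<xi> s = conv_at T \<phi> (conv T \<eta> \<xi>) s"
proof
  fix p
  obtain G i where Gi: "s = (G, i)" by (cases s)
  have fG: "fgraph G" using specified_graphs_fgraph(2)[OF s] Gi by simp
  show "conv_at T (conv T \<phi> \<eta>) \<xi> s p = conv_at T \<phi> (conv T \<eta> \<xi>) s p"
  proof (cases "p \<in> momentum_space G")
    case p: True
    \<comment> \<open>The common summand in terms of \<open>t = r/q\<close>: removing the internal
      half-edges of \<open>q\<close> and then those of \<open>t\<close> from \<open>G\<close>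
      amounts to removing those of \<open>r\<close>.\<close>
    define F where "F = (\<lambda>(q, t). at_graph \<phi> q p *
      (at_graph \<eta> t (restr (halfs G - internal (fst q)) p) *
       at_graph \<xi> (contract_spec (contract_spec s q) t)
         (restr (halfs G - internal (fst q) - internal (fst t)) p)))"
    have fin: "finite (theory_subgraphs T s)" using finite_theory_subgraphs[OF T s] .
    have sub: "r \<in> specified_graphs T" "contract_spec s r \<in> specified_graphs T"
        "covering_subgraph (fst r) G"
      if "r \<in> theory_subgraphs T s" for r
      using that Gi by (auto simp: theory_subgraphs_def spec_subgraph_def)
    have "conv_at T (conv T \<phi> \<eta>) \<xi> s p =
        (\<Sum>r\<in>theory_subgraphs T s. \<Sum>q\<in>theory_subgraphs T r. F (q, contract_spec r q))"
    proof -
      have "conv_at T \<phi> \<eta> r p * at_graph \<xi> (contract_spec s r) (restr (halfs G - internal (fst r)) p) =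
          (\<Sum>q\<in>theory_subgraphs T r. F (q, contract_spec r q))" if r: "r \<in> theory_subgraphs T s" for r
      proof -
        have pr: "p \<in> momentum_space (fst r)"
          using momentum_space_covering_subgraph[OF sub(3)[OF r] fG p] .
        have "at_graph \<phi> q p * at_graph \<eta> (contract_spec r q) (restr (halfs (fst r) - internal (fst q)) p) *
            at_graph \<xi> (contract_spec s r) (restr (halfs G - internal (fst r)) p) = F (q, contract_spec r q)"
          if q: "q \<in> theory_subgraphs T r" for q
        proof -
          have qr: "covering_subgraph (fst q) (fst r)"
            using q by (auto simp: theory_subgraphs_def spec_subgraph_def)
          interpret t: tower "fst q" "fst r" G "snd q"
            using fG sub(3)[OF r] qr by unfold_locales
          have "contract_spec (contract_spec s q) (contract_spec r q) = contract_spec s r"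
            using t.contract_contract[of i "snd r"] Gi by simp
          moreover have "fst (contract_spec r q) = t.R.K"
            using fst_contract_spec[of "fst r" "snd r" "fst q" "snd q"] by simp
          moreover have "halfs G - internal (fst q) - internal t.R.K = halfs G - internal (fst r)"
            unfolding t.R.internal_K using t.R.sub(6) by blast
          ultimately show ?thesis
            using covering_subgraphD(3)[OF sub(3)[OF r] fG] by (simp add: F_def)
        qed
        then show ?thesis
          unfolding conv_at_inside[OF pr] sum_distrib_right by (rule sum.cong[OF refl])
      qed
      then show ?thesis
        using conv_at_inside[of p s T "conv T \<phi> \<eta>" \<xi>] p Gi by (simp add: at_graph_conv)
    qed
    also have "\<dots> = (\<Sum>x\<in>(SIGMA r:theory_subgraphs T s. theory_subgraphs T r).
        F ((\<lambda>(r, q). (q, contract_spec r q)) x))"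
      using fin finite_theory_subgraphs[OF T sub(1)] by (subst sum.Sigma) (auto simp: case_prod_unfold)
    also have "\<dots> = (\<Sum>x\<in>(SIGMA q:theory_subgraphs T s. theory_subgraphs T (contract_spec s q)). F x)"
      by (rule sum.reindex_bij_betw[OF bij_betw_contract_spec[OF s]])
    also have "\<dots> = (\<Sum>q\<in>theory_subgraphs T s. \<Sum>t\<in>theory_subgraphs T (contract_spec s q). F (q, t))"
      using fin finite_theory_subgraphs[OF T sub(2)] by (subst sum.Sigma) auto
    also have "\<dots> = conv_at T \<phi> (conv T \<eta> \<xi>) s p"
    proof -
      have "(\<Sum>t\<in>theory_subgraphs T (contract_spec s q). F (q, t)) = at_graph \<phi> q p *
          conv_at T \<eta> \<xi> (contract_spec s q) (restr (halfs G - internal (fst q)) p)"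
        if q: "q \<in> theory_subgraphs T s" for q
      proof -
        interpret Q: covering G "fst q" "snd q"
          using fG sub(3)[OF q] by unfold_locales
        have K: "fst (contract_spec s q) = Q.K"
          using fst_contract_spec[of G i "fst q" "snd q"] Gi by simp
        have H: "halfs Q.K = halfs G - internal (fst q)"
          by (rule contract_typed_simps(2))
        \<comment> \<open>Conservation of momentum after contraction puts the argument in the right
          space; off it the inner \<open>conv_at\<close> would take its default value 0.\<close>
        have "restr (halfs G - internal (fst q)) p \<in> momentum_space (fst (contract_spec s q))"
          using Q.restr_momentum_space[OF p] unfolding K H .
        note inside = conv_at_inside[OF this]
        have "restr (halfs G - internal (fst q) - internal (fst t)) (restr (halfs G - internal (fst q)) p) =
            restr (halfs G - internal (fst q) - internal (fst t)) p" for t :: "('v, 'h, 'e) spec_graph"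
          unfolding restr_restr by (rule arg_cong[of _ _ "\<lambda>A. restr A p"]) auto
        then show ?thesis
          unfolding inside K H F_def by (simp add: sum_distrib_left)
      qed
      then show ?thesis
        using conv_at_inside[of p s T \<phi> "conv T \<eta> \<xi>"] p Gi by (simp add: at_graph_conv)
    qed
    finally show ?thesis .
  qed (simp add: conv_at_outside Gi)
qed

section \<open>Associativity\<close>

lemma has_internal_edge_cut:
  assumes "covering_subgraph g G" "fgraph G" "g \<noteq> G"
  shows "internal G - internal g \<noteq> {}"
proof
  assume "internal G - internal g = {}"
  moreover have "covering_subgraph G G" using assms(2) by (intro covering_subgraphI) auto
  ultimately show False
    using covering_subgraph_eqI[OF assms(2,1)] covering_subgraphD(6)[OF assms(1,2)] assms(3) by blast
qed

text \<open>A proper covering subgraph cuts an edge of the only component, so it leaves no component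
  whole and \<open>i\<close> puts no constraint on its specification; the full subgraph must carry
  \<open>i\<close> itself. Thus only one member of the index set mentions \<open>i\<close>.\<close>

lemma theory_subgraphs_connected:
  fixes G :: "('v::linorder, 'h, 'e) tgraph"
  assumes con: "connected_graph G" and s: "(G, i) \<in> specified_graphs T"
  shows "theory_subgraphs T (G, i) =
    insert (G, i) {(g, j) \<in> specified_graphs T. covering_subgraph g G \<and> g \<noteq> G}"
proof -
  have fG: "fgraph G" using specified_graphs_fgraph(2)[OF s] by simp
  have GG: "covering_subgraph G G" using fG by (intro covering_subgraphI) auto
  have proper: "spec_subgraph (g, j) (G, i)" if g: "covering_subgraph g G" "g \<noteq> G" for g j
  proof -
    obtain h where h: "h \<in> internal G" "h \<notin> internal g"
      using has_internal_edge_cut[OF g(1) fG g(2)] by auto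
    have "\<not> avoids G (internal G - internal g) v" if "v \<in> verts G" for v
      using h connected_graph_comp_of[OF con that] fgraph_bd[OF fG internal_halfs[OF h(1)]]
      by (auto simp: avoids_def)
    then show ?thesis unfolding spec_subgraph_iff[OF fG] using g(1) by simp
  qed
  have whole: "spec_subgraph (G, j) (G, i) \<longleftrightarrow> j = i" if j: "(G, j) \<in> specified_graphs T" for j
  proof
    assume "spec_subgraph (G, j) (G, i)"
    then have "j (comp_of G v) = i (comp_of G v)" if "v \<in> verts G" for v
      using that unfolding spec_subgraph_iff[OF fG] by (simp add: avoids_def)
    then show "j = i"
      using j s by (intro extensional_pi0_eqI[of j G i]) (simp_all add: specified_graphs_iff)
  qed (simp add: spec_subgraph_iff[OF fG] GG)
  have "(g, j) \<in> theory_subgraphs T (G, i) \<longleftrightarrow>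
      (g, j) \<in> insert (G, i) {(g, j) \<in> specified_graphs T. covering_subgraph g G \<and> g \<noteq> G}" for g j
    unfolding theory_subgraphs_eq[OF s] using proper[of g j] whole[of j] s
    by (cases "g = G") (auto simp: spec_subgraph_def)
  then show ?thesis by auto
qed

text \<open>Only the term of the full subgraph could see the index of the component, and there the
  second factor is the value at a graph without internal edges.\<close>

lemma conv_at_connected:
  fixes G :: "('v::linorder, 'h, 'e) tgraph"
    and \<phi> \<eta> :: "('v, 'h, 'e, 'd::finite) graph_map"
  assumes T: "qft T" and L: "\<phi> \<in> L_tilde T" "\<eta> \<in> L_tilde T" and con: "connected_graph G"
    and s: "(G, i) \<in> specified_graphs T" and s': "(G, i') \<in> specified_graphs T"
  shows "conv_at T \<phi> \<eta> (G, i) = conv_at T \<phi> \<eta> (G, i')"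
proof
  fix p
  have fG: "fgraph G" using specified_graphs_fgraph(2)[OF s] by simp
  let ?N = "{(g, j) \<in> specified_graphs T. covering_subgraph g G \<and> g \<noteq> G}"
  have indep: "at_graph \<psi> (H, l) = at_graph \<psi> (H, l')"
    if "\<psi> \<in> L_tilde T" "(H, l) \<in> specified_graphs T" "(H, l') \<in> specified_graphs T"
    for \<psi> :: "('v, 'h, 'e, 'd) graph_map" and H l l'
  proof -
    have "\<psi> (gen (H, l)) = \<psi> (gen (H, l'))" using that unfolding L_tilde_def by blast
    then show ?thesis by (simp add: at_graph_def)
  qed
  \<comment> \<open>\<open>contract_typed\<close> does not involve \<open>i\<close>, so the two
    contractions are the same graph with possibly different specifications, which
    \<open>\<eta>\<close> does not distinguish.\<close>
  have term_eq: "at_graph \<eta> (contract_spec (G, i) r) = at_graph \<eta> (contract_spec (G, i') r)"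
    if r: "r \<in> ?N" for r
  proof -
    have "r \<in> theory_subgraphs T (G, i)" "r \<in> theory_subgraphs T (G, i')"
      using r theory_subgraphs_connected[OF con s] theory_subgraphs_connected[OF con s'] by auto
    then have 1: "contract_spec (G, i) r \<in> specified_graphs T" "contract_spec (G, i') r \<in> specified_graphs T"
      by (simp_all add: theory_subgraphs_def)
    obtain g j where "r = (g, j)" by (cases r)
    then show ?thesis using 1 unfolding \<open>r = (g, j)\<close> contract_spec_eq by (intro indep[OF L(2)])
  qed
  have full: "at_graph \<eta> (contract_spec (G, l) (G, l)) (restr (halfs G - internal G) p) = 1"
    if l: "(G, l) \<in> specified_graphs T" and p: "p \<in> momentum_space G" for l
  proof -
    have "covering_subgraph G G" using fG by (intro covering_subgraphI) auto
    then interpret C: covering G G l using fG by unfold_locales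
    have "(G, l) \<in> theory_subgraphs T (G, l)" using theory_subgraphs_connected[OF con l] by simp
    then have "contract_spec (G, l) (G, l) \<in> specified_graphs T" by (simp add: theory_subgraphs_def)
    moreover obtain b where b: "contract_spec (G, l) (G, l) = (C.K, b)"
      using contract_spec_eq by blast
    ultimately have "(C.K, b) \<in> specified_graphs T" by simp
    moreover have "internal C.K = {}" by (simp add: C.internal_K)
    moreover have "\<And>H l. (H, l) \<in> specified_graphs T \<and> internal H = {} \<Longrightarrow> \<eta> (gen (H, l)) H = one_V H"
      using L(2) unfolding L_tilde_def by blast
    ultimately have "\<eta> (gen (C.K, b)) C.K = one_V C.K" by blast
    \<comment> \<open>\<open>one_V\<close> is 1 on the momentum space and 0 off it, so the
      restricted momentum has to be shown to lie there.\<close>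
    moreover have "restr (halfs G - internal G) p \<in> momentum_space C.K"
      using C.restr_momentum_space[OF p] by (simp only: contract_typed_simps(2))
    ultimately show ?thesis by (simp add: b at_graph_def one_V_def)
  qed
  show "conv_at T \<phi> \<eta> (G, i) p = conv_at T \<phi> \<eta> (G, i') p"
  proof (cases "p \<in> momentum_space G")
    case True
    have N: "finite ?N" "(G, l) \<notin> ?N" for l
      using finite_theory_subgraphs[OF T s] theory_subgraphs_connected[OF con s] by auto
    have expand: "conv_at T \<phi> \<eta> (G, l) p = at_graph \<phi> (G, l) p + (\<Sum>r\<in>?N. at_graph \<phi> r p *
        at_graph \<eta> (contract_spec (G, l) r) (restr (halfs G - internal (fst r)) p))"
      if "(G, l) \<in> specified_graphs T" for l
      using conv_at_inside[of p "(G, l)" T \<phi> \<eta>] True N full[OF that True]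
      unfolding theory_subgraphs_connected[OF con that] by simp
    show ?thesis
      unfolding expand[OF s] expand[OF s'] indep[OF L(1) s s']
      by (intro arg_cong2[of _ _ _ _ "(+)"] refl sum.cong) (simp add: term_eq)
  qed (simp add: conv_at_outside)
qed

theorem theorem3:
  fixes T :: "'e qft"
    and \<phi> \<eta> \<xi> :: "('v::linorder, 'h, 'e, 'd::finite) graph_map"
  assumes "qft T"
    and "\<phi> \<in> L_tilde T" and "\<eta> \<in> L_tilde T" and "\<xi> \<in> L_tilde T"
  shows "(\<forall>G i i'. connected_graph G \<and> (G, i) \<in> specified_graphs T \<and> (G, i') \<in> specified_graphs T \<longrightarrow>
            conv T \<phi> \<eta> (gen (G, i)) = conv T \<phi> \<eta> (gen (G, i'))) \<and>
         (\<forall>x\<in>H_tilde T. conv T (conv T \<phi> \<eta>) \<xi> x = conv T \<phi> (conv T \<eta> \<xi>) x)"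
proof (intro conjI allI impI ballI)
  fix G :: "('v, 'h, 'e) tgraph" and i i'
  assume "connected_graph G \<and> (G, i) \<in> specified_graphs T \<and> (G, i') \<in> specified_graphs T"
  then have c: "conv_at T \<phi> \<eta> (G, i) = conv_at T \<phi> \<eta> (G, i')"
    using conv_at_connected[OF assms(1-3)] by blast
  show "conv T \<phi> \<eta> (gen (G, i)) = conv T \<phi> \<eta> (gen (G, i'))"
    unfolding conv_gen c ..
next
  fix x :: "('v, 'h, 'e) spec_graph \<Rightarrow>\<^sub>0 complex"
  assume "x \<in> H_tilde T"
  then have "s \<in> specified_graphs T" if "s \<in> Poly_Mapping.keys x" for s
    using that by (auto simp: H_tilde_def)
  then show "conv T (conv T \<phi> \<eta>) \<xi> x = conv T \<phi> (conv T \<eta> \<xi>) x"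
    \<comment> \<open>The instances unfold only the outer products; both are sums over the same keys
      with the same coefficients, so the claim at generators suffices.\<close>
    unfolding conv_def[of T "conv T \<phi> \<eta>"] conv_def[of T \<phi> "conv T \<eta> \<xi>"]
    by (intro ext sum.cong refl) (simp add: conv_at_assoc[OF assms(1)])
qed

end
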